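(* Let $R,T,S>0$, $\beta\in(0,2)$ and $q\in[0,2)$. For $\gamma>\sqrt2$, set $$U_*=\sqrt{\frac1{4R}\log\frac{n}{64\gamma^2\log(ep)}}.$$ Let $n$ be large enough such that $U_*\ge\max\{(3T/R)^{1/(2-\beta)},(\bar c/T)^{1/\beta},1\}$ for some numerical constant $\bar c>0$. Let $$\tau(U_* )=6\gamma\,\frac{e^{RU_*^2+3TU_*^\beta}}{U_*^2}\Big(\frac{\log(ep)}{n}\Big)^{1/2}+3TU_*^{-2+\beta},$$ and let $\hat\Sigma^H_\tau$ be the spectral hard thresholding estimator with threshold $\tau$ built from the spectral covariance estimator with spectral radius $U=U_*$. Then for any $\tau\ge\tau(U_* )$ we have $$\sup_{(\Sigma,\psi)\in\mathcal{G}_q(S,R)\times\mathcal{H}_\beta(T)}\mathbb{P}_{\Sigma,\psi}\big(\|\hat\Sigma^H_\tau-\Sigma\|\ge\bar C_1\bar r_{n,p}\big)\le\bar C_0p^{2-\gamma^2}$$ with $$\bar r_{n,p}:=S^{1/2}\Big(R^{1-\beta/2}\,T\Big(\log\frac{n}{\log(ep)}\Big)^{-1+\beta/2}\Big)^{1-q/2}$$ for some numerical constants $\bar C_0,\bar C_1>0$.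
   Context: Model: $Y_j=X_j+\varepsilon_j$, $j=1,\dots,n$, where $X_1,\dots,X_n$ are i.i.d. $\mathcal N(0,\Sigma)$ in $\mathbb{R}^p$ and $\varepsilon_1,\dots,\varepsilon_n$ are i.i.d. random vectors in $\mathbb{R}^p$, independent of $X_1,\dots,X_n$, with characteristic function $\psi(u)=\mathbb{E}[e^{i\langle u,\varepsilon_1\rangle}]$. Only $Y_1,\dots,Y_n$ are observed, and $\mathbb{P}_{\Sigma,\psi}$ denotes their joint distribution. For a vector or matrix $x$, $|x|_q^q$ is the sum of the $q$-th powers of the absolute values of its entries for $q>0$; $|x|_0$ is the number of non-zero entries; $|x|_\infty$ is the largest absolute value of the entries. $\|A\|=\sqrt{\operatorname{tr}(A^\top A)}$ is the Frobenius norm. Noise class: $\mathcal{H}_\beta(T)=\{\psi\text{ characteristic function on }\mathbb{R}^p:\ |\log|\psi(u)||\le T(1+|u|_\beta^\beta),\ u\in\mathbb{R}^p\}$. Sparsity classes: $\mathcal{G}_0(S,R)$ is the set of symmetric positive definite $\Sigma\in\mathbb{R}^{p\times p}$ with $|\Sigma|_0\le S$ and $|\Sigma|_\infty\le R$; for $q\in(0,2)$, $\mathcal{G}_q(S,R)$ is the set of symmetric positive definite $\Sigma\in\mathbb{R}^{p\times p}$ with $|\Sigma|_q^q\le S$ and $|\Sigma|_\infty\le R$. Empirical characteristic function: $\varphi_n(u)=\frac1n\sum_{j=1}^n e^{i\langle u,Y_j\rangle}$, with $\operatorname{Re}\log\varphi_n(u)=\log|\varphi_n(u)|$ if $\varphi_n(u)\ne0$,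 and $\log\varphi_n(u):=0$ if $\varphi_n(u)=0$. Let $u^{(i)}$ be the $i$-th canonical basis vector of $\mathbb{R}^p$ and $u^{(i,j)}=\frac1{\sqrt2}(u^{(i)}+u^{(j)})$ for $i\ne j$. The spectral covariance estimator $\hat\Sigma=(\hat\sigma_{i,j})_{i,j=1,\dots,p}$ with spectral radius $U$ is $$\hat\sigma_{i,i}=-\frac{1}{U^2}\operatorname{Re}\log\varphi_n(Uu^{(i)}),\qquad \hat\sigma_{i,j}=-\frac{1}{U^2}\operatorname{Re}\log\varphi_n(Uu^{(i,j)})-\frac12(\hat\sigma_{i,i}+\hat\sigma_{j,j})\quad(i\ne j).$$ The spectral hard thresholding estimator with threshold $\tau>0$ is $\hat\Sigma^H_\tau=(\hat\sigma_{i,j}\mathbf{1}_{\{|\hat\sigma_{i,j}|>\tau\}})_{i,j=1,\dots,p}$.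
   Formalization: As printed the bound is false (the estimator targets Σ/2; large τ kills all entries): here twice the thresholded estimator is compared with Σ, the bound has the extra factor (τ/τ(U_* ))^(1-q/2), and C̄_1 may depend on β and γ. *)

theory Defs
  imports "HOL-Probability.Probability"
begin

text \<open>
  The dimension \<open>p\<close> has to be an ordinary variable, because the constants of the theorem do not
  depend on it.  Hence a vector in \<open>\<real>\<^sup>p\<close> is a function \<open>nat \<Rightarrow> real\<close> and a \<open>p \<times> p\<close> matrix a
  function \<open>nat \<Rightarrow> nat \<Rightarrow> real\<close>, and only the entries with indices below \<open>p\<close> matter
  (indices run from \<open>0\<close> to \<open>p - 1\<close>).  Random vectors live on the product space
  \<open>vec_space p\<close>.
\<close>

type_synonym rvec = "nat \<Rightarrow> real"
type_synonym rmat = "nat \<Rightarrow> nat \<Rightarrow> real"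

definition vec_space :: "nat \<Rightarrow> rvec measure" where
  "vec_space p = (\<Pi>\<^sub>M i\<in>{..<p}. borel)"

definition ip :: "nat \<Rightarrow> rvec \<Rightarrow> rvec \<Rightarrow> real" where
  "ip p u v = (\<Sum>i<p. u i * v i)"

definition mat_vec :: "nat \<Rightarrow> rmat \<Rightarrow> rvec \<Rightarrow> rvec" where
  "mat_vec p A u = (\<lambda>i. \<Sum>j<p. A i j * u j)"

definition frob_norm :: "nat \<Rightarrow> rmat \<Rightarrow> real" where
  "frob_norm p A = sqrt (\<Sum>j<p. \<Sum>i<p. A i j * A i j)"

definition mat_card_nonzero :: "nat \<Rightarrow> rmat \<Rightarrow> nat" where
  "mat_card_nonzero p A = card {(i, j). i < p \<and> j < p \<and> A i j \<noteq> 0}"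

definition mat_sum_powr :: "nat \<Rightarrow> real \<Rightarrow> rmat \<Rightarrow> real" where
  "mat_sum_powr p q A = (\<Sum>i<p. \<Sum>j<p. \<bar>A i j\<bar> powr q)"

definition mat_max_abs :: "nat \<Rightarrow> rmat \<Rightarrow> real" where
  "mat_max_abs p A = Max {\<bar>A i j\<bar> | i j. i < p \<and> j < p}"

definition symmetric_mat :: "nat \<Rightarrow> rmat \<Rightarrow> bool" where
  "symmetric_mat p A \<longleftrightarrow> (\<forall>i<p. \<forall>j<p. A i j = A j i)"

definition pos_definite :: "nat \<Rightarrow> rmat \<Rightarrow> bool" where
  "pos_definite p A \<longleftrightarrow> (\<forall>u. (\<exists>i<p. u i \<noteq> 0) \<longrightarrow> ip p u (mat_vec p A u) > 0)"

definition sparse_class :: "nat \<Rightarrow> real \<Rightarrow> real \<Rightarrow> real \<Rightarrow> rmat set" where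
  "sparse_class p q S R =
     {A. symmetric_mat p A \<and> pos_definite p A \<and>
         (if q = 0 then real (mat_card_nonzero p A) else mat_sum_powr p q A) \<le> S \<and>
         mat_max_abs p A \<le> R}"


definition vec_law :: "nat \<Rightarrow> rvec measure \<Rightarrow> bool" where
  "vec_law p \<mu> \<longleftrightarrow> prob_space \<mu> \<and> sets \<mu> = sets (vec_space p)"

definition vec_char :: "nat \<Rightarrow> rvec measure \<Rightarrow> rvec \<Rightarrow> complex" where
  "vec_char p \<mu> u = (CLINT x|\<mu>. iexp (ip p u x))"

definition has_char_fun :: "nat \<Rightarrow> rvec measure \<Rightarrow> (rvec \<Rightarrow> complex) \<Rightarrow> bool" where
  "has_char_fun p \<nu> \<psi> \<longleftrightarrow> vec_law p \<nu> \<and> (\<forall>u. \<psi> u = vec_char p \<nu> u)"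

text \<open>
  The condition \<open>\<psi> u \<noteq> 0\<close> is part of the bound on \<open>log |\<psi>|\<close> (a zero would make it infinite) and has
  to be written out because of the convention \<open>ln 0 = 0\<close>.
\<close>

definition noise_class :: "nat \<Rightarrow> real \<Rightarrow> real \<Rightarrow> (rvec \<Rightarrow> complex) set" where
  "noise_class p \<beta> T =
     {\<psi>. (\<exists>\<nu>. has_char_fun p \<nu> \<psi>) \<and>
         (\<forall>u. \<psi> u \<noteq> 0 \<and> \<bar>ln (cmod (\<psi> u))\<bar> \<le> T * (1 + (\<Sum>i<p. \<bar>u i\<bar> powr \<beta>)))}"

text \<open>
  The normal law \<open>N(0, A)\<close> with positive definite \<open>A\<close>: every nontrivial linear functional \<open>\<langle>u, X\<rangle>\<close> is
  univariate normal with mean \<open>0\<close> and variance \<open>\<langle>u, A u\<rangle>\<close> (\<open>normal_density\<close> takes the standard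
  deviation as its second argument).
\<close>

definition gaussian_law :: "nat \<Rightarrow> rmat \<Rightarrow> rvec measure \<Rightarrow> bool" where
  "gaussian_law p A \<mu> \<longleftrightarrow> vec_law p \<mu> \<and>
     (\<forall>u. (\<exists>i<p. u i \<noteq> 0) \<longrightarrow>
        distributed \<mu> lborel (ip p u) (normal_density 0 (sqrt (ip p u (mat_vec p A u)))))"

text \<open>
  The joint law of \<open>Y 0, \<dots>, Y (n - 1)\<close>, where \<open>Y j = X j + \<epsilon> j\<close>, the \<open>X j\<close> have law \<open>\<mu>\<close>, the
  \<open>\<epsilon> j\<close> have law \<open>\<nu>\<close>, and all these vectors are independent.
\<close>

definition sample_space :: "nat \<Rightarrow> nat \<Rightarrow> (nat \<Rightarrow> rvec) measure" where
  "sample_space n p = (\<Pi>\<^sub>M j\<in>{..<n}. vec_space p)"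

definition obs_law ::
    "nat \<Rightarrow> nat \<Rightarrow> rvec measure \<Rightarrow> rvec measure \<Rightarrow> (nat \<Rightarrow> rvec) measure" where
  "obs_law n p \<mu> \<nu> =
     distr ((\<Pi>\<^sub>M j\<in>{..<n}. \<mu>) \<Otimes>\<^sub>M (\<Pi>\<^sub>M j\<in>{..<n}. \<nu>)) (sample_space n p)
       (\<lambda>(x, e). \<lambda>j\<in>{..<n}. \<lambda>i\<in>{..<p}. x j i + e j i)"

text \<open>
  \<open>A\<close> and \<open>\<psi>\<close> determine the laws of \<open>X j\<close> and \<open>\<epsilon> j\<close> (a law on \<open>\<real>\<^sup>p\<close> is determined by its
  one-dimensional projections, and by its characteristic function), so \<open>P\<close> below is unique.
\<close>

definition joint_law ::
    "nat \<Rightarrow> nat \<Rightarrow> rmat \<Rightarrow> (rvec \<Rightarrow> complex) \<Rightarrow> (nat \<Rightarrow> rvec) measure \<Rightarrow> bool" where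
  "joint_law n p A \<psi> P \<longleftrightarrow>
     (\<exists>\<mu> \<nu>. gaussian_law p A \<mu> \<and> has_char_fun p \<nu> \<psi> \<and> P = obs_law n p \<mu> \<nu>)"


definition emp_char :: "nat \<Rightarrow> nat \<Rightarrow> (nat \<Rightarrow> rvec) \<Rightarrow> rvec \<Rightarrow> complex" where
  "emp_char n p Y u = (\<Sum>j<n. iexp (ip p u (Y j))) / of_nat n"

definition re_log :: "complex \<Rightarrow> real" where
  "re_log z = (if z = 0 then 0 else ln (cmod z))"

definition unit_dir :: "nat \<Rightarrow> rvec" where
  "unit_dir i = (\<lambda>k. if k = i then 1 else 0)"

definition pair_dir :: "nat \<Rightarrow> nat \<Rightarrow> rvec" where
  "pair_dir i j = (\<lambda>k. (unit_dir i k + unit_dir j k) / sqrt 2)"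

definition spectral_diag :: "nat \<Rightarrow> nat \<Rightarrow> real \<Rightarrow> (nat \<Rightarrow> rvec) \<Rightarrow> nat \<Rightarrow> real" where
  "spectral_diag n p U Y i = - (1 / U\<^sup>2) * re_log (emp_char n p Y (\<lambda>k. U * unit_dir i k))"

text \<open>
  Under \<open>N(0, \<Sigma>)\<close> the modulus of the characteristic function is \<open>exp (- \<langle>u, \<Sigma> u\<rangle> / 2)\<close> times that of
  the noise.  With the factor \<open>1 / U\<^sup>2\<close>, the matrix \<open>spectral_cov\<close> and its thresholded version
  therefore estimate \<open>\<Sigma> / 2\<close>, and twice the estimator has to be compared with \<open>\<Sigma>\<close>.
\<close>

definition spectral_cov :: "nat \<Rightarrow> nat \<Rightarrow> real \<Rightarrow> (nat \<Rightarrow> rvec) \<Rightarrow> rmat" where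
  "spectral_cov n p U Y = (\<lambda>i j.
     if i = j then spectral_diag n p U Y i
     else - (1 / U\<^sup>2) * re_log (emp_char n p Y (\<lambda>k. U * pair_dir i j k))
          - (1 / 2) * (spectral_diag n p U Y i + spectral_diag n p U Y j))"

definition hard_threshold :: "real \<Rightarrow> rmat \<Rightarrow> rmat" where
  "hard_threshold \<tau> A = (\<lambda>i j. if \<bar>A i j\<bar> > \<tau> then A i j else 0)"

definition U_star :: "nat \<Rightarrow> nat \<Rightarrow> real \<Rightarrow> real \<Rightarrow> real" where
  "U_star n p R \<gamma> =
     sqrt (1 / (4 * R) * ln (real n / (64 * \<gamma>\<^sup>2 * ln (exp 1 * real p))))"

definition tau_bound ::
    "nat \<Rightarrow> nat \<Rightarrow> real \<Rightarrow> real \<Rightarrow> real \<Rightarrow> real \<Rightarrow> real \<Rightarrow> real" where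
  "tau_bound n p R T \<beta> \<gamma> U =
     6 * \<gamma> * (exp (R * U\<^sup>2 + 3 * T * U powr \<beta>) / U\<^sup>2) *
       (ln (exp 1 * real p) / real n) powr (1 / 2)
     + 3 * T * U powr (-2 + \<beta>)"

definition rate :: "nat \<Rightarrow> nat \<Rightarrow> real \<Rightarrow> real \<Rightarrow> real \<Rightarrow> real \<Rightarrow> real \<Rightarrow> real" where
  "rate n p q S R T \<beta> =
     S powr (1 / 2) *
     (R powr (1 - \<beta> / 2) * T * (ln (real n / ln (exp 1 * real p))) powr (-1 + \<beta> / 2))
       powr (1 - q / 2)"

end

theory Submission
  imports Defs
begin

text \<open>
  The observations are i.i.d. with characteristic function \<open>exp (- \<langle>u, \<Sigma> u\<rangle> / 2) \<psi> u\<close>.  Hoeffding's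
  inequality for the real and imaginary parts bounds \<open>|\<phi>\<^sub>n - \<phi>|\<close> by \<open>2 \<gamma> sqrt (log (e p) / n)\<close> in all
  \<open>p\<^sup>2\<close> directions at once, except with probability \<open>4 p\<^sup>2 (e p) powr (- \<gamma>\<^sup>2)\<close>.  By the choice of
  \<open>U\<close> this is at most \<open>|\<phi>| / 4\<close>, so the logarithm can be linearised with the constant \<open>4/3\<close>.  An
  off-diagonal entry uses two such logarithms, which costs \<open>8/3\<close> of the \<open>3\<close> available in \<open>tau_bound\<close>,
  and has bias at most \<open>(1 + 2 powr (1 - \<beta>/2)) T U powr (\<beta> - 2)\<close>, again less than the \<open>3\<close> available.
  Hence every entry has error at most \<open>c \<tau>\<close> with \<open>c < 1\<close> depending on \<open>\<beta>\<close> only, and hard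
  thresholding commits a squared error of order \<open>\<tau> powr (2 - q) |\<Sigma> i j| powr q\<close> per entry.  Finally
  \<open>tau_bound\<close> is of the order \<open>T U powr (\<beta> - 2)\<close> because \<open>T U powr \<beta> \<ge> cbar\<close>.
\<close>

subsection \<open>Laws and characteristic functions of the observations\<close>

lemma ip_measurable [measurable]: "ip p u \<in> borel_measurable (vec_space p)"
  unfolding ip_def vec_space_def by measurable

lemma ip_measurable_law:
  assumes "vec_law p \<mu>" shows "ip p u \<in> borel_measurable \<mu>"
  using assms ip_measurable measurable_cong_sets unfolding vec_law_def by blast

text \<open>Dividing \<open>ip p u\<close> by its standard deviation, which is positive by positive
  definiteness, gives a standard normal variable; the claim is the standard normal characteristic
  function evaluated at that standard deviation.\<close>

lemma vec_char_gaussian: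
  assumes "gaussian_law p A \<mu>" "pos_definite p A" and u: "\<exists>i<p. u i \<noteq> 0"
  shows "vec_char p \<mu> u = complex_of_real (exp (- (ip p u (mat_vec p A u)) / 2))"
proof -
  have law: "vec_law p \<mu>" and X: "distributed \<mu> lborel (ip p u) (normal_density 0 (sqrt (ip p u (mat_vec p A u))))"
    using assms by (auto simp: gaussian_law_def)
  interpret prob_space \<mu> using law by (simp add: vec_law_def)
  have pos: "ip p u (mat_vec p A u) > 0"
    using assms by (auto simp: pos_definite_def)
  define \<sigma> where "\<sigma> = sqrt (ip p u (mat_vec p A u))"
  have \<sigma>: "\<sigma> > 0" using pos by (simp add: \<sigma>_def)
  have Z: "distributed \<mu> lborel (\<lambda>x. (ip p u x - 0) / \<sigma>) std_normal_density"
    using X normal_standard_normal_convert[OF \<sigma>, of "ip p u" 0] unfolding \<sigma>_def by blast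
  have "vec_char p \<mu> u = (CLINT x|\<mu>. iexp (\<sigma> * ((ip p u x - 0) / \<sigma>)))"
    unfolding vec_char_def using \<sigma> by (intro Bochner_Integration.integral_cong) auto
  also have "\<dots> = (CLINT z|distr \<mu> lborel (\<lambda>x. (ip p u x - 0) / \<sigma>). iexp (\<sigma> * z))"
    using distributed_measurable[OF Z] by (intro integral_distr[symmetric]) auto
  also have "\<dots> = char std_normal_distribution \<sigma>"
    unfolding char_def distributed_distr_eq_density[OF Z] ..
  also have "\<dots> = complex_of_real (exp (- (\<sigma>^2) / 2))"
    by (simp add: char_std_normal_distribution)
  finally show ?thesis using pos by (simp add: \<sigma>_def)
qed

text \<open>Regroups independent families of \<mu>'s and \<nu>'s into independent pairs. Two
  measures on a finite product agree once they agree on boxes, and on a box the measure factorises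
  over the index, first in \<open>e\<close> for fixed \<open>x\<close>, then in
  \<open>x\<close>.\<close>

lemma PiM_pair_distr:
  assumes "prob_space \<mu>" "prob_space \<nu>" "finite I" and f: "f \<in> measurable (\<mu> \<Otimes>\<^sub>M \<nu>) L"
  shows "distr ((\<Pi>\<^sub>M j\<in>I. \<mu>) \<Otimes>\<^sub>M (\<Pi>\<^sub>M j\<in>I. \<nu>)) (\<Pi>\<^sub>M j\<in>I. L) (\<lambda>(x, e). \<lambda>j\<in>I. f (x j, e j))
       = (\<Pi>\<^sub>M j\<in>I. distr (\<mu> \<Otimes>\<^sub>M \<nu>) L f)" (is "distr ?Q ?L ?g = ?P")
proof -
  interpret \<mu>: prob_space \<mu> by fact
  interpret \<nu>: prob_space \<nu> by fact
  interpret pair_prob_space \<mu> \<nu> ..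
  interpret \<rho>: prob_space "distr (\<mu> \<Otimes>\<^sub>M \<nu>) L f"
    by (rule prob_space_distr) fact
  interpret M: product_prob_space "\<lambda>_. \<mu>" I ..
  interpret N: product_prob_space "\<lambda>_. \<nu>" I ..
  interpret R: product_sigma_finite "\<lambda>_. distr (\<mu> \<Otimes>\<^sub>M \<nu>) L f" ..
  note [measurable] = f
  have g[measurable]: "?g \<in> measurable ?Q ?L"
    by measurable
  show ?thesis
  proof (rule R.PiM_eqI)
    show "finite I" by fact
    show "sets (distr ?Q ?L ?g) = sets ?P" by (auto intro!: sets_PiM_cong)
    fix A assume "\<And>i. i \<in> I \<Longrightarrow> A i \<in> sets (distr (\<mu> \<Otimes>\<^sub>M \<nu>) L f)"
    then have A: "\<And>i. i \<in> I \<Longrightarrow> A i \<in> sets L" by simp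
    define C where "C j = f -` A j \<inter> space (\<mu> \<Otimes>\<^sub>M \<nu>)" for j
    have C: "C j \<in> sets (\<mu> \<Otimes>\<^sub>M \<nu>)" if "j \<in> I" for j
      unfolding C_def using A[OF that] by measurable
    have PA: "Pi\<^sub>E I A \<in> sets ?L" using A \<open>finite I\<close> by (intro sets_PiM_I_finite) auto
    \<comment> \<open>For fixed \<open>x\<close> the section of the preimage of a box is again a box
      in \<open>e\<close>, so \<open>emeasure_PiM\<close> applies to it.\<close>
    have slice: "Pair x -` (?g -` Pi\<^sub>E I A \<inter> space ?Q) = (\<Pi>\<^sub>E j\<in>I. Pair (x j) -` C j)"
      if "x \<in> space (\<Pi>\<^sub>M j\<in>I. \<mu>)" for x
    proof (rule set_eqI)
      fix e
      have "f (x j, e j) \<in> space L" if "e \<in> space (\<Pi>\<^sub>M j\<in>I. \<nu>)" "j \<in> I" for j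
        using \<open>x \<in> _\<close> that measurable_space[OF f, of "(x j, e j)"]
        by (auto simp: space_PiM space_pair_measure)
      then show "e \<in> Pair x -` (?g -` Pi\<^sub>E I A \<inter> space ?Q) \<longleftrightarrow> e \<in> (\<Pi>\<^sub>E j\<in>I. Pair (x j) -` C j)"
        using that by (auto simp: C_def space_pair_measure space_PiM PiE_iff extensional_def)
    qed
    have "emeasure (distr ?Q ?L ?g) (Pi\<^sub>E I A) = emeasure ?Q (?g -` Pi\<^sub>E I A \<inter> space ?Q)"
      by (rule emeasure_distr[OF g PA])
    also have "\<dots> = (\<integral>\<^sup>+ x. emeasure (\<Pi>\<^sub>M j\<in>I. \<nu>) (Pair x -` (?g -` Pi\<^sub>E I A \<inter> space ?Q)) \<partial>(\<Pi>\<^sub>M j\<in>I. \<mu>))"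
      by (intro sigma_finite_measure.emeasure_pair_measure_alt prob_space_imp_sigma_finite
        prob_space_PiM assms measurable_sets[OF g PA])
    also have "\<dots> = (\<integral>\<^sup>+ x. (\<Prod>j\<in>I. emeasure \<nu> (Pair (x j) -` C j)) \<partial>(\<Pi>\<^sub>M j\<in>I. \<mu>))"
    proof (rule nn_integral_cong)
      fix x assume x: "x \<in> space (\<Pi>\<^sub>M j\<in>I. \<mu>)"
      show "emeasure (\<Pi>\<^sub>M j\<in>I. \<nu>) (Pair x -` (?g -` Pi\<^sub>E I A \<inter> space ?Q)) = (\<Prod>j\<in>I. emeasure \<nu> (Pair (x j) -` C j))"
        unfolding slice[OF x] using C \<open>finite I\<close>
        by (intro N.emeasure_PiM) (auto intro!: sets_Pair1)
    qed
    also have "\<dots> = (\<Prod>j\<in>I. \<integral>\<^sup>+ x. emeasure \<nu> (Pair x -` C j) \<partial>\<mu>)"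
      using C \<open>finite I\<close> by (intro M.product_nn_integral_prod) (auto intro: \<nu>.measurable_emeasure_Pair)
    also have "\<dots> = (\<Prod>j\<in>I. emeasure (distr (\<mu> \<Otimes>\<^sub>M \<nu>) L f) (A j))"
      using A by (intro prod.cong refl)
        (simp add: \<nu>.emeasure_pair_measure_alt[OF C, symmetric] emeasure_distr[OF f], simp add: C_def)
    finally show "emeasure (distr ?Q ?L ?g) (Pi\<^sub>E I A) = (\<Prod>i\<in>I. emeasure (distr (\<mu> \<Otimes>\<^sub>M \<nu>) L f) (A i))" .
  qed
qed

definition sum_law :: "nat \<Rightarrow> rvec measure \<Rightarrow> rvec measure \<Rightarrow> rvec measure" where
  "sum_law p \<mu> \<nu> = distr (\<mu> \<Otimes>\<^sub>M \<nu>) (vec_space p) (\<lambda>(x, e). \<lambda>i\<in>{..<p}. x i + e i)"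

lemma vec_add_measurable:
  assumes "vec_law p \<mu>" "vec_law p \<nu>"
  shows "(\<lambda>(x, e). \<lambda>i\<in>{..<p}. x i + e i) \<in> measurable (\<mu> \<Otimes>\<^sub>M \<nu>) (vec_space p)"
proof -
  have "sets (\<mu> \<Otimes>\<^sub>M \<nu>) = sets (vec_space p \<Otimes>\<^sub>M vec_space p)"
    using assms by (intro sets_pair_measure_cong) (auto simp: vec_law_def)
  moreover have "(\<lambda>(x, e). \<lambda>i\<in>{..<p}. x i + e i) \<in> measurable (vec_space p \<Otimes>\<^sub>M vec_space p) (vec_space p)"
    unfolding vec_space_def by measurable
  ultimately show ?thesis using measurable_cong_sets by blast
qed

lemma vec_law_sum_law:
  assumes "vec_law p \<mu>" "vec_law p \<nu>"
  shows "vec_law p (sum_law p \<mu> \<nu>)"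
proof -
  interpret \<mu>: prob_space \<mu> using assms by (simp add: vec_law_def)
  interpret \<nu>: prob_space \<nu> using assms by (simp add: vec_law_def)
  interpret pair_prob_space \<mu> \<nu> ..
  show ?thesis unfolding vec_law_def sum_law_def
    using prob_space_distr[OF vec_add_measurable[OF assms]] by simp
qed

text \<open>The data form an i.i.d. sample from \<open>sum_law p \<mu> \<nu>\<close>; from here on
  signal and noise enter the probabilistic part only through this one law.\<close>

lemma obs_law_eq_PiM:
  assumes "vec_law p \<mu>" "vec_law p \<nu>"
  shows "obs_law n p \<mu> \<nu> = (\<Pi>\<^sub>M j\<in>{..<n}. sum_law p \<mu> \<nu>)"
  using PiM_pair_distr[OF _ _ _ vec_add_measurable[OF assms], of "{..<n}"] assms
  by (simp add: obs_law_def sum_law_def sample_space_def vec_law_def)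

lemma vec_char_sum_law:
  assumes "vec_law p \<mu>" "vec_law p \<nu>"
  shows "vec_char p (sum_law p \<mu> \<nu>) u = vec_char p \<mu> u * vec_char p \<nu> u"
proof -
  interpret \<mu>: prob_space \<mu> using assms by (simp add: vec_law_def)
  interpret \<nu>: prob_space \<nu> using assms by (simp add: vec_law_def)
  interpret pair_prob_space \<mu> \<nu> ..
  note [measurable] = vec_add_measurable[OF assms] ip_measurable_law[OF assms(1)] ip_measurable_law[OF assms(2)]
  have add: "ip p u (\<lambda>i\<in>{..<p}. x i + e i) = ip p u x + ip p u e" for x e
    by (simp add: ip_def sum.distrib[symmetric] algebra_simps)
  have "vec_char p (sum_law p \<mu> \<nu>) u = (CLINT z|\<mu> \<Otimes>\<^sub>M \<nu>. iexp (ip p u (case z of (x, e) \<Rightarrow> \<lambda>i\<in>{..<p}. x i + e i)))"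
    unfolding vec_char_def sum_law_def by (rule integral_distr) measurable
  also have "\<dots> = (CLINT z|\<mu> \<Otimes>\<^sub>M \<nu>. iexp (ip p u (fst z)) * iexp (ip p u (snd z)))"
    by (intro Bochner_Integration.integral_cong) (auto simp: add exp_add ring_distribs)
  also have "\<dots> = (CLINT x|\<mu>. CLINT e|\<nu>. iexp (ip p u x) * iexp (ip p u e))"
    by (subst integral_fst'[symmetric]) (auto intro!: P.integrable_const_bound[where B = 1] simp: norm_mult)
  also have "\<dots> = vec_char p \<mu> u * vec_char p \<nu> u"
    by (simp add: vec_char_def)
  finally show ?thesis .
qed

section \<open>Concentration of the empirical characteristic function\<close>

text \<open>Independence means that the joint law is the product of the marginals. Points of the
  product space are already restricted to \<open>I\<close>, so the joint law is the law of the
  identity.\<close>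

lemma indep_vars_PiM_components:
  assumes "\<And>i. i \<in> I \<Longrightarrow> prob_space (M i)" "I \<noteq> {}"
  shows "prob_space.indep_vars (PiM I M) M (\<lambda>i f. f i) I"
proof -
  interpret prob_space "PiM I M" by (intro prob_space_PiM assms)
  have "distr (PiM I M) (PiM I M) (\<lambda>x. restrict x I) = distr (PiM I M) (PiM I M) (\<lambda>x. x)"
    by (intro distr_cong refl) (auto simp: space_PiM)
  moreover have "(\<Pi>\<^sub>M i\<in>I. distr (PiM I M) (M i) (\<lambda>f. f i)) = PiM I M"
    by (intro PiM_cong refl distr_PiM_component assms)
  ultimately show ?thesis using assms(2)
    by (subst indep_vars_iff_distr_eq_PiM') (auto simp: restrict_def distr_id2)
qed

lemma Hoeffding_PiM:
  fixes f :: "'a \<Rightarrow> real" and n :: nat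
  assumes "prob_space \<rho>" and f[measurable]: "f \<in> borel_measurable \<rho>" and bnd: "\<And>x. \<bar>f x\<bar> \<le> 1"
    and n: "n > 0" and t: "t \<ge> 0"
  shows "measure (\<Pi>\<^sub>M j\<in>{..<n}. \<rho>) {Y \<in> space (\<Pi>\<^sub>M j\<in>{..<n}. \<rho>).
           t \<le> \<bar>(\<Sum>j<n. f (Y j)) / n - (\<integral>x. f x \<partial>\<rho>)\<bar>} \<le> 2 * exp (- real n * t\<^sup>2 / 2)"
proof -
  let ?P = "\<Pi>\<^sub>M j\<in>{..<n}. \<rho>"
  interpret \<rho>: prob_space \<rho> by fact
  interpret P: prob_space ?P by (rule prob_space_PiM) (rule assms)
  have ind: "P.indep_vars (\<lambda>_. borel) (\<lambda>j Y. f (Y j)) {..<n}"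
    by (rule P.indep_vars_compose2[OF indep_vars_PiM_components]) (use n in \<open>auto intro: assms\<close>)
  have E: "P.expectation (\<lambda>Y. f (Y j)) = (\<integral>x. f x \<partial>\<rho>)" if "j < n" for j
  proof -
    have "(\<integral>x. f x \<partial>\<rho>) = (\<integral>x. f x \<partial>distr ?P \<rho> (\<lambda>Y. Y j))"
      using that by (subst distr_PiM_component) (auto intro: assms)
    also have "\<dots> = P.expectation (\<lambda>Y. f (Y j))"
      using that by (subst integral_distr) auto
    finally show ?thesis ..
  qed
  interpret H: Hoeffding_ineq ?P "{..<n}" "\<lambda>j Y. f (Y j)" "\<lambda>_. -1" "\<lambda>_. 1" "n * (\<integral>x. f x \<partial>\<rho>)"
  proof unfold_locales
    show "AE Y in ?P. f (Y j) \<in> {- 1..1}" for j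
      using bnd by (intro always_eventually) (simp add: abs_le_iff minus_le_iff)
    show "n * (\<integral>x. f x \<partial>\<rho>) \<equiv> \<Sum>j<n. P.expectation (\<lambda>Y. f (Y j))"
      by (simp add: E)
  qed (simp_all add: ind)
  have "{Y \<in> space ?P. t \<le> \<bar>(\<Sum>j<n. f (Y j)) / n - (\<integral>x. f x \<partial>\<rho>)\<bar>}
      = {Y \<in> space ?P. n * t \<le> \<bar>(\<Sum>j<n. f (Y j)) - n * (\<integral>x. f x \<partial>\<rho>)\<bar>}"
  proof (intro Collect_cong conj_cong refl)
    fix Y
    have "\<bar>(\<Sum>j<n. f (Y j)) - n * (\<integral>x. f x \<partial>\<rho>)\<bar> = n * \<bar>(\<Sum>j<n. f (Y j)) / n - (\<integral>x. f x \<partial>\<rho>)\<bar>"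
      using n abs_mult[of "real n" "(\<Sum>j<n. f (Y j)) / n - (\<integral>x. f x \<partial>\<rho>)"]
      by (simp add: right_diff_distrib)
    then show "t \<le> \<bar>(\<Sum>j<n. f (Y j)) / n - (\<integral>x. f x \<partial>\<rho>)\<bar> \<longleftrightarrow> n * t \<le> \<bar>(\<Sum>j<n. f (Y j)) - n * (\<integral>x. f x \<partial>\<rho>)\<bar>"
      using n by simp
  qed
  also have "measure ?P \<dots> \<le> 2 * exp (- 2 * (n * t)\<^sup>2 / (\<Sum>i<n. (1 - (- 1))\<^sup>2))"
    using n t by (intro H.Hoeffding_ineq_abs_ge) auto
  \<comment> \<open>Each summand ranges over [-1, 1], of length 2, so the denominator is 4
    n.\<close>
  also have "- 2 * (n * t)\<^sup>2 / (\<Sum>i<n. (1 - (- 1))\<^sup>2) = - real n * t\<^sup>2 / 2"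
    using n by (simp add: power2_eq_square field_simps)
  finally show ?thesis .
qed

text \<open>The real and imaginary parts are averages of cos and sin, both bounded by 1. Each
  two-sided Hoeffding bound costs a factor 2, which makes 4, and two coordinate errors of size t
  give a modulus of at most sqrt 2 * t. The exceptional set is delivered as a measurable set so that
  a union bound can be taken over directions.\<close>

lemma emp_char_deviation:
  assumes law: "vec_law p \<rho>" and n: "n > 0" and t: "t \<ge> 0"
  shows "\<exists>B\<in>sets (\<Pi>\<^sub>M j\<in>{..<n}. \<rho>). measure (\<Pi>\<^sub>M j\<in>{..<n}. \<rho>) B \<le> 4 * exp (- real n * t\<^sup>2 / 2) \<and>
     (\<forall>Y\<in>space (\<Pi>\<^sub>M j\<in>{..<n}. \<rho>) - B. cmod (emp_char n p Y u - vec_char p \<rho> u) \<le> sqrt 2 * t)"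
proof -
  let ?P = "\<Pi>\<^sub>M j\<in>{..<n}. \<rho>"
  have prob: "prob_space \<rho>" using law by (simp add: vec_law_def)
  interpret \<rho>: prob_space \<rho> by fact
  interpret P: prob_space ?P by (rule prob_space_PiM) (rule prob)
  note [measurable] = ip_measurable_law[OF law]
  define bad where "bad f = {Y \<in> space ?P. t \<le> \<bar>(\<Sum>j<n. f (ip p u (Y j))) / n - (\<integral>x. f (ip p u x) \<partial>\<rho>)\<bar>}"
    for f :: "real \<Rightarrow> real"
  have [measurable]: "bad cos \<in> sets ?P" "bad sin \<in> sets ?P"
    unfolding bad_def by measurable
  have bad: "measure ?P (bad cos) \<le> 2 * exp (- real n * t\<^sup>2 / 2)" "measure ?P (bad sin) \<le> 2 * exp (- real n * t\<^sup>2 / 2)"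
    unfolding bad_def using n t prob
    by (intro Hoeffding_PiM[where f = "\<lambda>x. cos (ip p u x)"] Hoeffding_PiM[where f = "\<lambda>x. sin (ip p u x)"]; simp)+
  have int: "integrable \<rho> (\<lambda>x. iexp (ip p u x))"
    by (auto intro!: \<rho>.integrable_const_bound[where B = 1])
  have char: "Re (vec_char p \<rho> u) = (\<integral>x. cos (ip p u x) \<partial>\<rho>)" "Im (vec_char p \<rho> u) = (\<integral>x. sin (ip p u x) \<partial>\<rho>)"
    unfolding vec_char_def using int by (simp_all add: Re_exp Im_exp flip: integral_Re integral_Im)
  have emp: "Re (emp_char n p Y u) = (\<Sum>j<n. cos (ip p u (Y j))) / n"
    "Im (emp_char n p Y u) = (\<Sum>j<n. sin (ip p u (Y j))) / n" for Y
    unfolding emp_char_def by (simp_all add: Re_exp Im_exp Re_divide_of_nat Im_divide_of_nat)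
  show ?thesis
  proof (intro bexI[of _ "bad cos \<union> bad sin"] conjI ballI)
    have "measure ?P (bad cos \<union> bad sin) \<le> measure ?P (bad cos) + measure ?P (bad sin)"
      by (intro measure_Un_le) measurable
    then show "measure ?P (bad cos \<union> bad sin) \<le> 4 * exp (- real n * t\<^sup>2 / 2)" using bad by linarith
    fix Y assume Y: "Y \<in> space ?P - (bad cos \<union> bad sin)"
    let ?z = "emp_char n p Y u - vec_char p \<rho> u"
    have "\<bar>Re ?z\<bar> \<le> t" "\<bar>Im ?z\<bar> \<le> t" using Y by (auto simp: bad_def char emp)
    then have "(Re ?z)\<^sup>2 \<le> t\<^sup>2" "(Im ?z)\<^sup>2 \<le> t\<^sup>2" using t by (auto simp: abs_le_square_iff[symmetric])
    then have "cmod ?z \<le> sqrt (2 * t\<^sup>2)" unfolding cmod_def by (intro real_sqrt_le_mono) simp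
    then show "cmod ?z \<le> sqrt 2 * t" using t by (simp add: real_sqrt_mult)
  qed measurable
qed

text \<open>Fixes the sign of the log-modulus of the noise, on which the one-sided bias bounds
  rest.\<close>

lemma char_fun_le_1:
  assumes "has_char_fun p \<nu> \<psi>" shows "cmod (\<psi> u) \<le> 1"
proof -
  interpret prob_space \<nu> using assms by (simp add: has_char_fun_def vec_law_def)
  have "cmod (\<psi> u) \<le> (\<integral>x. cmod (iexp (ip p u x)) \<partial>\<nu>)"
    using assms by (simp only: has_char_fun_def vec_char_def integral_norm_bound)
  then show ?thesis by (simp add: prob_space)
qed

subsection \<open>Entrywise error and thresholding\<close>

text \<open>With y = a / b both sides follow from ln z <= z - 1, applied to y and to 1 / y. The
  second gives (1 - y) / y, and y >= 3/4 is the source of the factor 4/3.\<close>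

lemma abs_ln_diff_le:
  fixes a b x :: real
  assumes "0 < b" "\<bar>a - b\<bar> \<le> x * b" "x \<le> 1/4"
  shows "0 < a" "\<bar>ln a - ln b\<bar> \<le> 4/3 * x"
proof -
  define y where "y = a / b"
  have x: "x \<ge> 0" using assms by (smt (verit) mult_nonneg_nonpos2 zero_less_mult_iff mult_less_0_iff)
  have a: "a = y * b" using assms by (simp add: y_def)
  have "\<bar>y - 1\<bar> * b \<le> x * b" using assms abs_mult[of "y - 1" b] unfolding a by (simp add: left_diff_distrib)
  then have y: "\<bar>y - 1\<bar> \<le> x" using assms by simp
  then have y0: "y > 0" using assms by linarith
  then show "0 < a" using assms a by simp
  have l: "ln a - ln b = ln y" using assms y0 by (simp add: a ln_mult)
  have up: "ln y \<le> 4/3 * x" using ln_le_minus_one[OF y0] y x by linarith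
  have "1 / y - 1 \<le> 4/3 * x"
  proof -
    have "1 - y \<le> x" "3/4 \<le> y" using y assms by linarith+
    then have "1 \<le> y + 4/3 * x * y" using mult_left_mono[of "3/4" y "4/3 * x"] x by simp
    then show ?thesis using y0 by (simp add: field_simps)
  qed
  then have "- ln y \<le> 4/3 * x" using ln_le_minus_one[of "1/y"] y0 by (simp add: ln_div)
  then show "\<bar>ln a - ln b\<bar> \<le> 4/3 * x" using up l by simp
qed

text \<open>A relative error of at most 1/4 keeps z away from 0, so the default value of
  \<open>re_log\<close> never enters.\<close>

lemma re_log_perturb:
  assumes "cmod (z - w) \<le> x * cmod w" "w \<noteq> 0" "x \<le> 1/4"
  shows "\<bar>re_log z - ln (cmod w)\<bar> \<le> 4/3 * x"
proof -
  have "\<bar>cmod z - cmod w\<bar> \<le> x * cmod w"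
    using assms(1) norm_triangle_ineq3[of z w] by linarith
  from abs_ln_diff_le[OF _ this \<open>x \<le> 1/4\<close>] assms(2) show ?thesis
    by (simp add: re_log_def split: if_splits)
qed

section \<open>Hard thresholding of sparse matrices\<close>

text \<open>Merges the two cases of \<open>sparse_class\<close> into one bound on
  \<open>mat_sum_powr\<close>; the convention \<open>0 powr 0 = 0\<close> makes this
  possible.\<close>

lemma mat_card_nonzero_eq: "real (mat_card_nonzero p A) = mat_sum_powr p 0 A"
proof -
  have "mat_sum_powr p 0 A = (\<Sum>(i, j)\<in>{..<p} \<times> {..<p}. if A i j \<noteq> 0 then 1 else 0)"
    unfolding mat_sum_powr_def by (subst sum.cartesian_product[symmetric]) (auto intro!: sum.cong)
  also have "\<dots> = (\<Sum>z\<in>({..<p} \<times> {..<p}) \<inter> {(i, j). A i j \<noteq> 0}. 1)"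
    by (subst sum.inter_restrict) (auto intro!: sum.cong)
  also have "({..<p} \<times> {..<p}) \<inter> {(i, j). A i j \<noteq> 0} = {(i, j). i < p \<and> j < p \<and> A i j \<noteq> 0}"
    by auto
  finally show ?thesis by (simp add: mat_card_nonzero_def)
qed

text \<open>
  \<open>x powr 0\<close> is the indicator of \<open>x \<noteq> 0\<close>, so that \<open>q = 0\<close> is included.
\<close>

lemma hard_threshold_error:
  fixes a s :: real
  assumes err: "\<bar>a - s\<bar> \<le> c * \<tau>" and "0 < \<tau>" "0 \<le> c" "c < 1" "0 \<le> q" "q < 2"
  shows "((if \<bar>a\<bar> > \<tau> then a else 0) - s)\<^sup>2 \<le> 4 / (1 - c)\<^sup>2 * \<tau> powr (2 - q) * \<bar>s\<bar> powr q"
proof -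
  have ct: "c * \<tau> \<le> \<tau>" using mult_right_mono[of c 1 \<tau>] assms by simp
  show ?thesis
  proof (cases "\<bar>a\<bar> > \<tau>")
    case True
    \<comment> \<open>A kept entry must have a true value above (1 - c) * \<tau>, so a factor
      \<open>\<tau> powr q\<close> can be traded for a multiple of
      \<open>\<bar>s\<bar> powr q\<close>.\<close>
    have "(1 - c) * \<tau> < \<bar>s\<bar>" using err True by (simp add: left_diff_distrib)
    then have s: "\<tau> < \<bar>s\<bar> / (1 - c)" using assms by (simp add: field_simps)
    have "(a - s)\<^sup>2 \<le> \<tau>\<^sup>2"
      using order_trans[OF err ct] assms by (simp add: abs_le_square_iff[symmetric])
    also have "\<tau>\<^sup>2 = \<tau> powr (2 - q) * \<tau> powr q"
      using assms by (simp add: powr_add[symmetric])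
    also have "\<dots> \<le> \<tau> powr (2 - q) * (\<bar>s\<bar> / (1 - c)) powr q"
      using s assms by (intro mult_left_mono powr_mono2) auto
    also have "(\<bar>s\<bar> / (1 - c)) powr q = \<bar>s\<bar> powr q * (1 / (1 - c)) powr q"
      using assms by (simp add: powr_mult[symmetric])
    also have "\<tau> powr (2 - q) * (\<bar>s\<bar> powr q * (1 / (1 - c)) powr q) \<le> \<tau> powr (2 - q) * (\<bar>s\<bar> powr q * (1 / (1 - c)) powr 2)"
      using assms by (intro mult_left_mono powr_mono) auto
    also have "\<dots> \<le> \<tau> powr (2 - q) * (\<bar>s\<bar> powr q * (4 / (1 - c)\<^sup>2))"
      using assms by (intro mult_left_mono) (auto simp: power_divide divide_right_mono)
    finally show ?thesis using True by (simp add: mult_ac)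
  next
    case False
    \<comment> \<open>For a dropped entry the error is s itself. Its part of exponent 2 - q is
      bounded through 2 * \<tau>, and \<open>2 powr (2 - q) \<le> 4\<close> is the 4 in the
      constant.\<close>
    have "\<bar>s\<bar> \<le> 2 * \<tau>" using err False ct by linarith
    then have "\<bar>s\<bar> powr (2 - q) \<le> (2 * \<tau>) powr (2 - q)"
      using assms by (intro powr_mono2) auto
    also have "\<dots> = 2 powr (2 - q) * \<tau> powr (2 - q)" using assms by (simp add: powr_mult)
    also have "2 powr (2 - q) \<le> (2 :: real) powr 2" using assms by (intro powr_mono) auto
    also have "(2 :: real) powr 2 \<le> 4 / (1 - c)\<^sup>2"
      using assms by (simp add: field_simps power_le_one)
    finally have "\<bar>s\<bar> powr (2 - q) \<le> 4 / (1 - c)\<^sup>2 * \<tau> powr (2 - q)" by (simp add: mult_right_mono)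
    then have "\<bar>s\<bar> powr (2 - q) * \<bar>s\<bar> powr q \<le> 4 / (1 - c)\<^sup>2 * \<tau> powr (2 - q) * \<bar>s\<bar> powr q"
      by (intro mult_right_mono) auto
    moreover have "\<bar>s\<bar> powr (2 - q) * \<bar>s\<bar> powr q = s\<^sup>2"
      by (cases "s = 0") (simp_all flip: powr_add)
    ultimately show ?thesis using False by simp
  qed
qed

text \<open>Since \<open>A\<close> estimates half of \<Sigma>, the squared error of an entry carries
  a factor 4, which with the 4 of \<open>hard_threshold_error\<close> makes 16, the square of the
  final 4. Summing over the entries turns \<open>\<bar>\<Sigma> i j\<bar> powr q\<close> into at
  most S.\<close>

lemma frob_norm_hard_threshold:
  assumes err: "\<And>i j. i < p \<Longrightarrow> j < p \<Longrightarrow> \<bar>A i j - \<Sigma> i j / 2\<bar> \<le> c * \<tau>"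
    and "0 < \<tau>" "0 \<le> c" "c < 1" "0 \<le> q" "q < 2" "mat_sum_powr p q \<Sigma> \<le> S"
  shows "frob_norm p (\<lambda>i j. 2 * hard_threshold \<tau> A i j - \<Sigma> i j)
           \<le> 4 / (1 - c) * S powr (1/2) * \<tau> powr (1 - q/2)"
proof -
  have S: "S \<ge> 0" using assms(7) unfolding mat_sum_powr_def
    by (meson order_trans sum_nonneg powr_ge_zero)
  let ?K = "16 / (1 - c)\<^sup>2 * \<tau> powr (2 - q)"
  have entry: "(2 * hard_threshold \<tau> A i j - \<Sigma> i j) * (2 * hard_threshold \<tau> A i j - \<Sigma> i j) \<le> ?K * \<bar>\<Sigma> i j\<bar> powr q"
    if "i < p" "j < p" for i j
  proof -
    have "(2 * hard_threshold \<tau> A i j - \<Sigma> i j) * (2 * hard_threshold \<tau> A i j - \<Sigma> i j)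
        = 4 * ((if \<bar>A i j\<bar> > \<tau> then A i j else 0) - \<Sigma> i j / 2)\<^sup>2"
      by (simp add: hard_threshold_def power2_eq_square algebra_simps)
    also have "\<dots> \<le> 4 * (4 / (1 - c)\<^sup>2 * \<tau> powr (2 - q) * \<bar>\<Sigma> i j / 2\<bar> powr q)"
      using hard_threshold_error[OF err[OF that] assms(2-6)] by simp
    also have "\<dots> \<le> 4 * (4 / (1 - c)\<^sup>2 * \<tau> powr (2 - q) * \<bar>\<Sigma> i j\<bar> powr q)"
      using assms by (intro mult_left_mono powr_mono2) auto
    finally show ?thesis by simp
  qed
  have "frob_norm p (\<lambda>i j. 2 * hard_threshold \<tau> A i j - \<Sigma> i j)
      \<le> sqrt (\<Sum>j<p. \<Sum>i<p. ?K * \<bar>\<Sigma> i j\<bar> powr q)"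
    unfolding frob_norm_def by (intro real_sqrt_le_mono sum_mono entry) auto
  also have "(\<Sum>j<p. \<Sum>i<p. ?K * \<bar>\<Sigma> i j\<bar> powr q) = ?K * mat_sum_powr p q \<Sigma>"
    unfolding mat_sum_powr_def by (subst sum.swap) (simp add: sum_distrib_left)
  also have "sqrt \<dots> \<le> sqrt (?K * S)"
    using assms by (intro real_sqrt_le_mono mult_left_mono) auto
  also have "?K * S = (4 / (1 - c) * S powr (1/2) * \<tau> powr (1 - q/2))\<^sup>2"
  proof -
    have "(\<tau> powr (1 - q/2))\<^sup>2 = \<tau> powr (2 - q)" by (simp add: power2_eq_square flip: powr_add)
    moreover have "(S powr (1/2))\<^sup>2 = S" using S by (simp add: powr_half_sqrt)
    ultimately show ?thesis by (simp only: power_mult_distrib power_divide) simp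
  qed
  finally show ?thesis using assms by simp
qed

section \<open>Quadratic forms and power sums in the two kinds of directions\<close>

lemma sum_indicator_lessThan:
  "i < p \<Longrightarrow> (\<Sum>k<p. f k * (if k = i then 1 else 0)) = f i" for f :: "nat \<Rightarrow> real"
  by (subst sum.cong[OF refl, of _ _ "\<lambda>k. if k = i then f k else 0"]) auto

lemma quad_form_unit_dir:
  assumes "i < p"
  shows "ip p (\<lambda>k. U * unit_dir i k) (mat_vec p A (\<lambda>k. U * unit_dir i k)) = U\<^sup>2 * A i i"
proof -
  have "mat_vec p A (\<lambda>k. U * unit_dir i k) = (\<lambda>r. U * A r i)"
    unfolding mat_vec_def unit_dir_def
    using sum_indicator_lessThan[OF assms, of "\<lambda>k. A r k * U" for r] by (simp add: mult_ac)
  then show ?thesis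
    using sum_indicator_lessThan[OF assms, of "\<lambda>k. U * (U * A k i)"]
    by (simp add: ip_def unit_dir_def power2_eq_square mult_ac)
qed

text \<open>The polarisation behind the estimator: for symmetric A this is U^2 times the
  off-diagonal entry plus half of the two diagonal forms.\<close>

lemma quad_form_pair_dir:
  assumes "i < p" "j < p"
  shows "ip p (\<lambda>k. U * pair_dir i j k) (mat_vec p A (\<lambda>k. U * pair_dir i j k))
       = U\<^sup>2 / 2 * (A i i + A i j + A j i + A j j)"
proof -
  have *: "(\<Sum>k<p. f k * (U * pair_dir i j k)) = U / sqrt 2 * (f i + f j)" for f
  proof -
    have "(\<Sum>k<p. f k * (U * pair_dir i j k))
        = (\<Sum>k<p. U / sqrt 2 * f k * (if k = i then 1 else 0) + U / sqrt 2 * f k * (if k = j then 1 else 0))"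
      by (intro sum.cong) (auto simp: pair_dir_def unit_dir_def)
    then show ?thesis
      unfolding sum.distrib sum_indicator_lessThan[OF assms(1)] sum_indicator_lessThan[OF assms(2)]
      by (simp add: distrib_left)
  qed
  have "mat_vec p A (\<lambda>k. U * pair_dir i j k) = (\<lambda>r. U / sqrt 2 * (A r i + A r j))"
    unfolding mat_vec_def * ..
  moreover have "ip p (\<lambda>k. U * pair_dir i j k) v = U / sqrt 2 * (v i + v j)" for v
    using *[of v] by (simp add: ip_def mult_ac)
  ultimately have "ip p (\<lambda>k. U * pair_dir i j k) (mat_vec p A (\<lambda>k. U * pair_dir i j k))
      = U / sqrt 2 * (U / sqrt 2) * (A i i + A i j + A j i + A j j)"
    by (simp only: distrib_left)
  also have "U / sqrt 2 * (U / sqrt 2) = U\<^sup>2 / 2" by (simp add: power2_eq_square)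
  finally show ?thesis .
qed

lemma powr_sum_unit_dir:
  assumes "i < p" "U > 0"
  shows "(\<Sum>k<p. \<bar>U * unit_dir i k\<bar> powr \<beta>) = U powr \<beta>"
proof -
  have "(\<Sum>k<p. \<bar>U * unit_dir i k\<bar> powr \<beta>) = (\<Sum>k<p. U powr \<beta> * (if k = i then 1 else 0))"
    using assms by (intro sum.cong) (auto simp: unit_dir_def)
  then show ?thesis using sum_indicator_lessThan[OF assms(1)] by simp
qed

text \<open>Two coordinates of size U / sqrt 2 contribute. For 0 < \<beta> < 2 the factor lies
  strictly between 1 and 2; being below 2 is what later leaves room below the threshold.\<close>

lemma powr_sum_pair_dir:
  assumes "i < p" "j < p" "i \<noteq> j" "U > 0"
  shows "(\<Sum>k<p. \<bar>U * pair_dir i j k\<bar> powr \<beta>) = 2 powr (1 - \<beta>/2) * U powr \<beta>"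
proof -
  let ?c = "(U / sqrt 2) powr \<beta>"
  have "(\<Sum>k<p. \<bar>U * pair_dir i j k\<bar> powr \<beta>)
      = (\<Sum>k<p. ?c * (if k = i then 1 else 0) + ?c * (if k = j then 1 else 0))"
    using assms by (intro sum.cong) (auto simp: pair_dir_def unit_dir_def)
  also have "\<dots> = 2 * ?c"
    using assms by (simp only: sum.distrib sum_indicator_lessThan)
  also have "?c = U powr \<beta> * 2 powr (- \<beta>/2)"
    using assms by (simp add: powr_divide powr_half_sqrt[symmetric] powr_powr powr_minus field_simps)
  also have "2 * (U powr \<beta> * 2 powr (- \<beta>/2)) = 2 powr (1 - \<beta>/2) * U powr \<beta>"
    using powr_add[of 2 1 "- \<beta>/2"] by simp
  finally show ?thesis .
qed

section \<open>Choice of the spectral radius and size of the threshold\<close>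

text \<open>The entries of the maximum say in turn that the Gaussian exponent dominates that of the
  noise, that the bias scale \<open>T * U powr \<beta>\<close> is at least 1, and that U >= 1.
  Solving the definition of \<open>U_star\<close> for n shows that 2 * \<gamma> * sqrt (L / n) is a
  quarter of exp (- 2 * R * U^2), the order of the smallest modulus to be estimated.\<close>

lemma U_star_conditions:
  assumes "0 < R" "0 < T" "0 < \<beta>" "\<beta> < 2" "0 < \<gamma>" "1 \<le> p"
    and U: "U = U_star n p R \<gamma>" and L: "L = ln (exp 1 * real p)"
    and M: "U \<ge> Max {(3 * T / R) powr (1 / (2 - \<beta>)), (1 / T) powr (1 / \<beta>), 1}"
  shows "1 \<le> U" "3 * T * U powr \<beta> \<le> R * U\<^sup>2" "1 \<le> T * U powr \<beta>" "1 \<le> L" "n > 0"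
    "4 * R * U\<^sup>2 = ln (real n / (64 * \<gamma>\<^sup>2 * L))"
    "sqrt (L / n) = exp (- 2 * R * U\<^sup>2) / (8 * \<gamma>)"
proof -
  show U1: "1 \<le> U" using M by simp
  show L1: "1 \<le> L" using assms by (simp add: ln_mult)
  have "(3 * T / R) powr (1 / (2 - \<beta>)) \<le> U" using M by simp
  then have "((3 * T / R) powr (1 / (2 - \<beta>))) powr (2 - \<beta>) \<le> U powr (2 - \<beta>)"
    using assms by (intro powr_mono2) auto
  then have "3 * T / R \<le> U powr (2 - \<beta>)" using assms by (simp add: powr_powr)
  then have "3 * T \<le> R * U powr (2 - \<beta>)" using assms by (simp add: field_simps)
  then have "3 * T * U powr \<beta> \<le> R * U powr (2 - \<beta>) * U powr \<beta>" by (intro mult_right_mono) auto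
  then show "3 * T * U powr \<beta> \<le> R * U\<^sup>2" using U1 by (simp add: mult.assoc flip: powr_add)
  have "(1 / T) powr (1 / \<beta>) \<le> U" using M by simp
  then have "((1 / T) powr (1 / \<beta>)) powr \<beta> \<le> U powr \<beta>"
    using assms by (intro powr_mono2) auto
  then have "1 / T \<le> U powr \<beta>" using assms by (simp add: powr_powr)
  then show "1 \<le> T * U powr \<beta>" using assms by (simp add: field_simps)
  let ?l = "1 / (4 * R) * ln (real n / (64 * \<gamma>\<^sup>2 * L))"
  have sq: "U = sqrt ?l" unfolding U L U_star_def ..
  have l0: "?l > 0" using U1 sq by (metis less_le_trans real_sqrt_gt_0_iff zero_less_one)
  \<comment> \<open>For n = 0 the convention \<open>ln 0 = 0\<close> makes the radicand
    \<open>?l\<close> vanish, although U >= 1.\<close>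
  show "n > 0"
  proof (rule ccontr)
    assume "\<not> n > 0" then show False using l0 by simp
  qed
  show ln_eq: "4 * R * U\<^sup>2 = ln (real n / (64 * \<gamma>\<^sup>2 * L))"
  proof -
    have "U\<^sup>2 = ?l" unfolding sq using l0 by (intro real_sqrt_pow2) simp
    then show ?thesis using assms(1) by simp
  qed
  have "exp (- 2 * R * U\<^sup>2) = sqrt (exp (- (4 * R * U\<^sup>2)))"
    by (rule real_sqrt_unique[symmetric]) (simp_all flip: exp_double)
  also have "exp (- (4 * R * U\<^sup>2)) = (8 * \<gamma>)\<^sup>2 * (L / n)"
    unfolding ln_eq exp_minus using \<open>n > 0\<close> L1 assms(5)
    by (subst exp_ln) (simp_all add: power_mult_distrib)
  also have "sqrt \<dots> = 8 * \<gamma> * sqrt (L / n)" using assms(5) by (simp only: real_sqrt_mult real_sqrt_abs)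
  finally show "sqrt (L / n) = exp (- 2 * R * U\<^sup>2) / (8 * \<gamma>)" using assms by simp
qed

text \<open>Separates a stochastic part and a bias part, each with weight 3, over U^2. The entrywise
  errors, multiplied by U^2, will be compared with these two parts.\<close>

lemma tau_bound_eq:
  assumes "U > 0"
  shows "tau_bound n p R T \<beta> \<gamma> U
    = (3 * (2 * \<gamma> * sqrt (ln (exp 1 * real p) / n) * exp (R * U\<^sup>2 + 3 * T * U powr \<beta>)) + 3 * (T * U powr \<beta>)) / U\<^sup>2"
proof -
  have "ln (exp 1 * real p) / n \<ge> 0" by (cases "p = 0") (simp_all add: ln_mult)
  then have "(ln (exp 1 * real p) / n) powr (1/2) = sqrt (ln (exp 1 * real p) / n)"
    by (rule powr_half_sqrt)
  moreover have "U powr (- 2 + \<beta>) = U powr \<beta> / U\<^sup>2"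
    using assms powr_diff[of U \<beta> 2] by simp
  ultimately show ?thesis
    by (simp add: tau_bound_def add_divide_distrib mult_ac)
qed

text \<open>The stochastic part is at most 3/4, hence at most 3/4 of
  \<open>T * U powr \<beta>\<close>, so the bias dominates with the constant 3 + 3/4 = 15/4. Passing
  from U^2 to ln (n / L) / R costs another factor 4 * K.\<close>

lemma tau_bound_le_rate:
  assumes pos: "0 < R" "0 < T" "0 < \<beta>" "\<beta> < 2" "1 \<le> \<gamma>" "1 \<le> p"
    and U: "U = U_star n p R \<gamma>" and L: "L = ln (exp 1 * real p)"
    and M: "U \<ge> Max {(3 * T / R) powr (1 / (2 - \<beta>)), (1 / T) powr (1 / \<beta>), 1}"
  shows "0 < ln (n / L)"
    "tau_bound n p R T \<beta> \<gamma> U \<le> 15 * (1 + ln (64 * \<gamma>\<^sup>2)) * (R powr (1 - \<beta>/2) * T * ln (n / L) powr (-1 + \<beta>/2))"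
proof -
  have \<gamma>: "0 < \<gamma>" using pos by simp
  note c = U_star_conditions[OF pos(1-4) \<gamma> pos(6) U L M]
  define E where "E = exp (R * U\<^sup>2 + 3 * T * U powr \<beta>)"
  define K where "K = 1 + ln (64 * \<gamma>\<^sup>2)"
  define a where "a = 1 - \<beta>/2"
  have a: "0 < a" "a < 1" using pos by (auto simp: a_def)
  have "\<gamma>\<^sup>2 \<ge> 1" using pos by simp
  then have K1: "K \<ge> 1" by (simp add: K_def)
  have "ln (n / L) = ln (n / (64 * \<gamma>\<^sup>2 * L)) + ln (64 * \<gamma>\<^sup>2)"
    using c \<gamma> by (simp add: ln_div ln_mult)
  then have ln_eq: "ln (n / L) = 4 * R * U\<^sup>2 + ln (64 * \<gamma>\<^sup>2)" using c by simp
  have RU: "1 \<le> 4 * R * U\<^sup>2" using c by linarith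
  show ln0: "0 < ln (n / L)" using ln_eq RU K1 by (simp add: K_def)
  \<comment> \<open>With z = 4 * R * U^2 >= 1 the additive constant becomes a factor: z + (K - 1) <=
    z * K.\<close>
  have "ln (n / L) \<le> 4 * R * U\<^sup>2 * K"
    using mult_right_mono[OF RU, of "K - 1"] K1 by (simp add: ln_eq K_def algebra_simps)
  then have "ln (n / L) / (4 * K * R) \<le> U\<^sup>2" using pos K1 by (simp add: field_simps)
  then have "(U\<^sup>2) powr (- a) \<le> (ln (n / L) / (4 * K * R)) powr (- a)"
    using a ln0 pos K1 by (intro powr_mono2') auto
  also have "\<dots> = (4 * K) powr a * R powr a * ln (n / L) powr (- a)"
    using ln0 pos K1 by (simp add: powr_divide powr_mult powr_minus field_simps)
  also have "(4 * K) powr a \<le> (4 * K) powr 1" using a K1 by (intro powr_mono) auto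
  also have "(U\<^sup>2) powr (- a) = U powr (\<beta> - 2)"
    using c by (simp add: powr_powr a_def flip: powr_numeral)
  finally have Ub: "U powr (\<beta> - 2) \<le> 4 * K * (R powr a * ln (n / L) powr (- a))"
    using K1 by (simp add: mult_right_mono mult.assoc)
  have "2 * \<gamma> * sqrt (L / n) * E \<le> 1/4"
  proof -
    have "2 * \<gamma> * sqrt (L / n) * E = exp (- 2 * R * U\<^sup>2 + (R * U\<^sup>2 + 3 * T * U powr \<beta>)) / 4"
      unfolding c(7) E_def exp_add using \<gamma> by simp
    also have "\<dots> \<le> 1/4" using c by simp
    finally show ?thesis .
  qed
  then have "3 * (2 * \<gamma> * sqrt (L / n) * E) + 3 * (T * U powr \<beta>) \<le> 15/4 * (T * U powr \<beta>)"
    using c(3) by linarith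
  moreover have eq: "tau_bound n p R T \<beta> \<gamma> U
      = (3 * (2 * \<gamma> * sqrt (L / n) * E) + 3 * (T * U powr \<beta>)) / U\<^sup>2"
    using c(1) by (simp only: tau_bound_eq L E_def)
  ultimately have "tau_bound n p R T \<beta> \<gamma> U \<le> 15/4 * (T * U powr \<beta>) / U\<^sup>2"
    unfolding eq by (intro divide_right_mono) auto
  also have "\<dots> = 15/4 * (T * U powr (\<beta> - 2))" using c by (simp add: powr_diff)
  also have "\<dots> \<le> 15/4 * (T * (4 * K * (R powr a * ln (n / L) powr (- a))))"
    using Ub pos by (intro mult_left_mono) auto
  also have "\<dots> = 15 * K * (R powr a * T * ln (n / L) powr (- a))" by simp
  also have "- a = -1 + \<beta>/2" by (simp add: a_def)
  finally show "tau_bound n p R T \<beta> \<gamma> U \<le> 15 * (1 + ln (64 * \<gamma>\<^sup>2)) * (R powr (1 - \<beta>/2) * T * ln (n / L) powr (-1 + \<beta>/2))"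
    unfolding K_def a_def .
qed

section \<open>Entrywise error of the spectral estimator\<close>

text \<open>The terms in A, D and s cancel. The three logarithms contribute 4/3 * x with weights 1,
  1/2 and 1/2, and the remaining bias - m + (k1 + k2) / 2 lies between - t1 and t2.\<close>

lemma off_diagonal_arith:
  fixes e r a b s A D m k1 k2 t1 t2 x W :: real
  assumes "e = - r + (a + b) / 2 - s / 2" "\<bar>r - (- (A + 2 * s + D) / 4 + m)\<bar> \<le> 4/3 * x"
    "\<bar>a - (- A / 2 + k1)\<bar> \<le> 4/3 * x" "\<bar>b - (- D / 2 + k2)\<bar> \<le> 4/3 * x"
    "- t1 \<le> k1" "k1 \<le> 0" "- t1 \<le> k2" "k2 \<le> 0" "- t2 \<le> m" "m \<le> 0" "t1 \<le> W" "t2 \<le> W"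
  shows "\<bar>e\<bar> \<le> 8/3 * x + W"
  using assms unfolding abs_le_iff by (auto simp: add_divide_distrib diff_divide_distrib)

text \<open>A deterministic statement: all randomness sits in the hypotheses \<open>dev\<close>.
  After multiplication by U^2 the error is at most 8/3 * x plus T * V * (1 + w), against 3 * x plus
  3 * T * V in the threshold; the two quotients form the maximum in the conclusion.\<close>

lemma spectral_cov_error:
  assumes pos: "0 < R" "0 < T" "0 < \<beta>" "\<beta> < 2" "0 < \<gamma>" "1 \<le> p"
    and U: "U = U_star n p R \<gamma>" and L: "L = ln (exp 1 * real p)"
    and M: "U \<ge> Max {(3 * T / R) powr (1 / (2 - \<beta>)), (1 / T) powr (1 / \<beta>), 1}"
    and sym: "symmetric_mat p \<Sigma>" and max: "mat_max_abs p \<Sigma> \<le> R"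
    and psi: "\<And>u. \<psi> u \<noteq> 0" "\<And>u. \<bar>ln (cmod (\<psi> u))\<bar> \<le> T * (1 + (\<Sum>i<p. \<bar>u i\<bar> powr \<beta>))" "\<And>u. cmod (\<psi> u) \<le> 1"
    and \<phi>: "\<And>u. \<exists>i<p. u i \<noteq> 0 \<Longrightarrow> \<phi> u = of_real (exp (- ip p u (mat_vec p \<Sigma> u) / 2)) * \<psi> u"
    and dev: "\<And>i. i < p \<Longrightarrow> cmod (emp_char n p Y (\<lambda>k. U * unit_dir i k) - \<phi> (\<lambda>k. U * unit_dir i k)) \<le> 2 * \<gamma> * sqrt (L / n)"
      "\<And>i j. i < p \<Longrightarrow> j < p \<Longrightarrow> i \<noteq> j \<Longrightarrow> cmod (emp_char n p Y (\<lambda>k. U * pair_dir i j k) - \<phi> (\<lambda>k. U * pair_dir i j k)) \<le> 2 * \<gamma> * sqrt (L / n)"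
    and ij: "i < p" "j < p"
  shows "\<bar>spectral_cov n p U Y i j - \<Sigma> i j / 2\<bar> \<le> max (8/9) ((1 + 2 powr (1 - \<beta>/2)) / 3) * tau_bound n p R T \<beta> \<gamma> U"
proof -
  note c = U_star_conditions[OF pos U L M]
  define E where "E = exp (R * U\<^sup>2 + 3 * T * U powr \<beta>)"
  define x where "x = 2 * \<gamma> * sqrt (L / n) * E"
  define w :: real where "w = 2 powr (1 - \<beta>/2)"
  define V where "V = U powr \<beta>"
  have U0: "U > 0" using c by simp
  have V: "1 \<le> V" using c pos by (simp add: V_def ge_one_powr_ge_zero)
  have w: "1 \<le> w" "w \<le> 2" using pos powr_mono[of "1 - \<beta>/2" 1 2] by (auto simp: w_def ge_one_powr_ge_zero)
  have x4: "x \<le> 1/4"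
  proof -
    have "x = exp (- 2 * R * U\<^sup>2 + (R * U\<^sup>2 + 3 * T * U powr \<beta>)) / 4"
      unfolding c(7) E_def exp_add x_def using pos by simp
    also have "\<dots> \<le> 1/4" using c by simp
    finally show ?thesis .
  qed
  have x0: "0 \<le> x" using pos c by (simp add: x_def E_def)
  have ent: "\<bar>\<Sigma> i j\<bar> \<le> R" if "i < p" "j < p" for i j
  proof -
    have fin: "finite {\<bar>\<Sigma> i j\<bar> |i j. i < p \<and> j < p}"
      by (rule finite_subset[of _ "(\<lambda>(i, j). \<bar>\<Sigma> i j\<bar>) ` ({..<p} \<times> {..<p})"]) auto
    have "\<bar>\<Sigma> i j\<bar> \<le> mat_max_abs p \<Sigma>"
      unfolding mat_max_abs_def using that by (intro Max_ge fin) auto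
    then show ?thesis using max by simp
  qed
  \<comment> \<open>The bounds on the quadratic form and on the power sum give
    \<open>cmod (\<phi> u) \<ge> 1 / E\<close>, so the absolute deviation becomes a relative error x
    <= 1/4.\<close>
  have dir: "\<bar>re_log (emp_char n p Y u) - (- ip p u (mat_vec p \<Sigma> u) / 2 + ln (cmod (\<psi> u)))\<bar> \<le> 4/3 * x"
    if nz: "\<exists>i<p. u i \<noteq> 0" and d: "cmod (emp_char n p Y u - \<phi> u) \<le> 2 * \<gamma> * sqrt (L / n)"
      and quad: "ip p u (mat_vec p \<Sigma> u) \<le> 2 * R * U\<^sup>2" and pw: "(\<Sum>k<p. \<bar>u k\<bar> powr \<beta>) \<le> w * V" for u
  proof -
    have nz': "\<phi> u \<noteq> 0" using psi \<phi>[OF nz] by simp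
    have ln\<phi>: "ln (cmod (\<phi> u)) = - ip p u (mat_vec p \<Sigma> u) / 2 + ln (cmod (\<psi> u))"
      using psi \<phi>[OF nz] by (simp add: norm_mult ln_mult)
    \<comment> \<open>The 3 in the exponent is 1 + w * V <= 3 * V, from w <= 2 and V >= 1.\<close>
    have "T * (1 + (\<Sum>i<p. \<bar>u i\<bar> powr \<beta>)) \<le> T * (3 * V)"
      using pw V mult_right_mono[OF w(2), of V] pos by (intro mult_left_mono) linarith+
    then have "ln (cmod (\<psi> u)) \<ge> - (3 * T * V)" using psi(2)[of u] by linarith
    then have "ln (cmod (\<phi> u)) \<ge> - (R * U\<^sup>2 + 3 * T * V)"
      using ln\<phi> quad by simp
    then have "exp (- (R * U\<^sup>2 + 3 * T * V)) \<le> cmod (\<phi> u)" using nz' by (simp add: ln_ge_iff)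
    then have "E * exp (- (R * U\<^sup>2 + 3 * T * V)) \<le> E * cmod (\<phi> u)"
      by (intro mult_left_mono) (auto simp: E_def)
    then have "1 \<le> E * cmod (\<phi> u)" by (simp add: E_def V_def flip: exp_add)
    then have "2 * \<gamma> * sqrt (L / n) * 1 \<le> 2 * \<gamma> * sqrt (L / n) * (E * cmod (\<phi> u))"
      using pos c by (intro mult_left_mono) auto
    then have "cmod (emp_char n p Y u - \<phi> u) \<le> x * cmod (\<phi> u)" using d by (simp add: x_def mult_ac)
    from re_log_perturb[OF this nz' x4] show ?thesis unfolding ln\<phi> .
  qed
  define k where "k i = ln (cmod (\<psi> (\<lambda>k. U * unit_dir i k)))" for i
  define m where "m i j = ln (cmod (\<psi> (\<lambda>k. U * pair_dir i j k)))" for i j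
  have k: "- (T * (1 + V)) \<le> k i" "k i \<le> 0" if "i < p" for i
    using psi(2,3)[of "\<lambda>k. U * unit_dir i k"] psi(1) powr_sum_unit_dir[OF that U0, of \<beta>]
    by (auto simp: k_def V_def)
  have m: "- (T * (1 + w * V)) \<le> m i j" "m i j \<le> 0" if "i < p" "j < p" "i \<noteq> j" for i j
    using psi(2,3)[of "\<lambda>k. U * pair_dir i j k"] psi(1) powr_sum_pair_dir[OF that U0, of \<beta>]
    by (auto simp: m_def V_def w_def)
  have diag: "\<bar>re_log (emp_char n p Y (\<lambda>k. U * unit_dir i k)) - (- (U\<^sup>2 * \<Sigma> i i) / 2 + k i)\<bar> \<le> 4/3 * x" if "i < p" for i
    unfolding k_def quad_form_unit_dir[OF that, symmetric]
  proof (rule dir)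
    show "\<exists>ia<p. U * unit_dir i ia \<noteq> 0" using that U0 by (auto simp: unit_dir_def)
    have "U\<^sup>2 * \<Sigma> i i \<le> U\<^sup>2 * (2 * R)" using ent[OF that that] pos by (intro mult_left_mono) auto
    then show "ip p (\<lambda>k. U * unit_dir i k) (mat_vec p \<Sigma> (\<lambda>k. U * unit_dir i k)) \<le> 2 * R * U\<^sup>2"
      by (simp add: quad_form_unit_dir[OF that] mult_ac)
    show "(\<Sum>k<p. \<bar>U * unit_dir i k\<bar> powr \<beta>) \<le> w * V"
      using powr_sum_unit_dir[OF that U0, of \<beta>] w V mult_right_mono[of 1 w V] by (simp add: V_def)
  qed (rule dev(1)[OF that])
  \<comment> \<open>Since \<open>|\<psi>| \<le> 1\<close>, all log-moduli are nonpositive, so the bias \<open>m i j - (k i + k j) / 2\<close> is at most the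
    larger of its two parts and not their sum; this keeps it strictly below the bias term of \<open>tau_bound\<close>.\<close>
  have TV: "T * (1 + V) \<le> T * V * (1 + w)" "T * (1 + w * V) \<le> T * V * (1 + w)"
    using pos w V mult_mono[of 1 w 1 V] mult_left_mono[of _ _ T, OF _ less_imp_le]
    by (auto simp: algebra_simps intro!: mult_left_mono)
  have "U\<^sup>2 * \<bar>spectral_cov n p U Y i j - \<Sigma> i j / 2\<bar> \<le> 8/3 * x + T * V * (1 + w)"
  proof (cases "i = j")
    case True
    have "U\<^sup>2 * (spectral_cov n p U Y i j - \<Sigma> i j / 2) = - (re_log (emp_char n p Y (\<lambda>k. U * unit_dir i k)) - (- (U\<^sup>2 * \<Sigma> i i) / 2))"
      using U0 by (simp add: True spectral_cov_def spectral_diag_def field_simps)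
    then have "\<bar>U\<^sup>2 * (spectral_cov n p U Y i j - \<Sigma> i j / 2)\<bar> \<le> 8/3 * x + T * V * (1 + w)"
      using diag[OF ij(1)] k[OF ij(1)] TV x0 by linarith
    then show ?thesis by (simp add: abs_mult)
  next
    case False
    have sij: "\<Sigma> j i = \<Sigma> i j" using sym ij by (auto simp: symmetric_mat_def)
    have q: "ip p (\<lambda>k. U * pair_dir i j k) (mat_vec p \<Sigma> (\<lambda>k. U * pair_dir i j k))
       = U\<^sup>2 / 2 * (\<Sigma> i i + 2 * \<Sigma> i j + \<Sigma> j j)"
      using quad_form_pair_dir[OF ij] sij by simp
    have off: "\<bar>re_log (emp_char n p Y (\<lambda>k. U * pair_dir i j k)) - (- (U\<^sup>2 / 2 * (\<Sigma> i i + 2 * \<Sigma> i j + \<Sigma> j j)) / 2 + m i j)\<bar> \<le> 4/3 * x"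
      unfolding m_def q[symmetric]
    proof (rule dir)
      show "\<exists>ia<p. U * pair_dir i j ia \<noteq> 0" using ij U0 False by (intro exI[of _ i]) (auto simp: unit_dir_def pair_dir_def)
      have "U\<^sup>2 / 2 * (\<Sigma> i i + 2 * \<Sigma> i j + \<Sigma> j j) \<le> U\<^sup>2 / 2 * (4 * R)"
        using ent[of i i] ent[of i j] ent[of j j] ij by (intro mult_left_mono) auto
      then show "ip p (\<lambda>k. U * pair_dir i j k) (mat_vec p \<Sigma> (\<lambda>k. U * pair_dir i j k)) \<le> 2 * R * U\<^sup>2"
        by (simp add: q mult_ac)
      show "(\<Sum>k<p. \<bar>U * pair_dir i j k\<bar> powr \<beta>) \<le> w * V"
        using powr_sum_pair_dir[OF ij False U0, of \<beta>] by (simp add: V_def w_def)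
    qed (rule dev(2)[OF ij False])
    let ?r = "re_log (emp_char n p Y (\<lambda>k. U * pair_dir i j k))"
    let ?a = "re_log (emp_char n p Y (\<lambda>k. U * unit_dir i k))"
    let ?b = "re_log (emp_char n p Y (\<lambda>k. U * unit_dir j k))"
    have eq: "U\<^sup>2 * (spectral_cov n p U Y i j - \<Sigma> i j / 2) = - ?r + (?a + ?b) / 2 - (U\<^sup>2 * \<Sigma> i j) / 2"
      using U0 False by (simp add: spectral_cov_def spectral_diag_def field_simps)
    have "- (U\<^sup>2 / 2 * (\<Sigma> i i + 2 * \<Sigma> i j + \<Sigma> j j)) / 2
        = - (U\<^sup>2 * \<Sigma> i i + 2 * (U\<^sup>2 * \<Sigma> i j) + U\<^sup>2 * \<Sigma> j j) / 4"
      by (simp add: field_simps)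
    note off' = off[unfolded this]
    have "\<bar>U\<^sup>2 * (spectral_cov n p U Y i j - \<Sigma> i j / 2)\<bar> \<le> 8/3 * x + T * V * (1 + w)"
      by (rule off_diagonal_arith[OF eq off' diag[OF ij(1)] diag[OF ij(2)] k[OF ij(1)] k[OF ij(2)]
        m[OF ij False] TV])
    then show ?thesis by (simp add: abs_mult)
  qed
  also have "\<dots> \<le> max (8/9) ((1 + w) / 3) * (3 * x) + max (8/9) ((1 + w) / 3) * (3 * (T * V))"
  proof -
    have "8/9 * (3 * x) \<le> max (8/9) ((1 + w) / 3) * (3 * x)" using x0 by (intro mult_right_mono) auto
    moreover have "(1 + w) / 3 * (3 * (T * V)) \<le> max (8/9) ((1 + w) / 3) * (3 * (T * V))"
      using pos V by (intro mult_right_mono) auto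
    moreover have "8/9 * (3 * x) = 8/3 * x" "(1 + w) / 3 * (3 * (T * V)) = T * V * (1 + w)" by simp_all
    ultimately show ?thesis by linarith
  qed
  also have "\<dots> = U\<^sup>2 * (max (8/9) ((1 + w) / 3) * tau_bound n p R T \<beta> \<gamma> U)"
    unfolding tau_bound_eq[OF U0] using U0
    by (simp only: x_def E_def V_def L distrib_left[symmetric]) simp
  finally show ?thesis using U0 by (simp add: w_def)
qed

subsection \<open>The risk bound\<close>

text \<open>The Frobenius bound scales with \<open>\<tau> powr (1 - q / 2)\<close>, whereas
  \<open>rate\<close> matches only the smallest admissible threshold; the quotient of the two
  thresholds accounts for the difference. The 60 is 4 * 15, from
  \<open>frob_norm_hard_threshold\<close> and \<open>tau_bound_le_rate\<close>.\<close>

lemma spectral_hard_threshold_deviation: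
  assumes pos: "0 < \<beta>" "\<beta> < 2" "1 \<le> \<gamma>" "0 < R" "0 < T" "0 < S" "0 \<le> q" "q < 2" "1 \<le> p"
    and M: "U_star n p R \<gamma> \<ge> Max {(3 * T / R) powr (1 / (2 - \<beta>)), (1 / T) powr (1 / \<beta>), 1}"
    and \<tau>: "\<tau> \<ge> tau_bound n p R T \<beta> \<gamma> (U_star n p R \<gamma>)"
    and \<Sigma>: "\<Sigma> \<in> sparse_class p q S R" and \<psi>: "\<psi> \<in> noise_class p \<beta> T" and P: "joint_law n p \<Sigma> \<psi> P"
    and C: "C = 60 * (1 + ln (64 * \<gamma>\<^sup>2)) / (1 - max (8/9) ((1 + 2 powr (1 - \<beta>/2)) / 3)) + 1"
  shows "emeasure P {Y \<in> space P.
            frob_norm p (\<lambda>i j. 2 * hard_threshold \<tau> (spectral_cov n p (U_star n p R \<gamma>) Y) i j - \<Sigma> i j)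
            \<ge> C * (\<tau> / tau_bound n p R T \<beta> \<gamma> (U_star n p R \<gamma>)) powr (1 - q / 2) * rate n p q S R T \<beta>}
       \<le> ennreal (4 * real p powr (2 - \<gamma>\<^sup>2))" (is "emeasure P ?bad \<le> _")
proof -
  define U where "U = U_star n p R \<gamma>"
  define L where "L = ln (exp 1 * real p)"
  define \<tau>\<^sub>0 where "\<tau>\<^sub>0 = tau_bound n p R T \<beta> \<gamma> U"
  \<comment> \<open>Chosen so that n * t^2 / 2 = \<gamma>^2 * L, which turns the Hoeffding bound
    into a power of e p.\<close>
  define t where "t = \<gamma> * sqrt (2 * L / n)"
  define c where "c = max (8/9) ((1 + 2 powr (1 - \<beta>/2)) / 3)"
  define K where "K = 1 + ln (64 * \<gamma>\<^sup>2)"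
  define B where "B = R powr (1 - \<beta>/2) * T * ln (n / L) powr (-1 + \<beta>/2)"
  define a where "a = 1 - q/2"
  have \<gamma>: "0 < \<gamma>" using pos by simp
  note U_facts = U_star_conditions[OF pos(4,5,1,2) \<gamma> pos(9) U_def L_def M[folded U_def]]
  note tau_rate = tau_bound_le_rate[OF pos(4,5,1,2,3,9) U_def L_def M[folded U_def]]
  have c: "0 \<le> c" "c < 1"
  proof -
    have "2 powr (1 - \<beta>/2) < (2::real) powr 1" using pos by (intro powr_less_mono) auto
    then show "0 \<le> c" "c < 1" by (auto simp: c_def)
  qed
  have "\<gamma>\<^sup>2 \<ge> 1" using pos by simp
  then have K: "K \<ge> 1" by (simp add: K_def)
  have B: "B > 0" using pos tau_rate(1) by (simp add: B_def)
  have \<tau>\<^sub>0: "0 < \<tau>\<^sub>0" "\<tau>\<^sub>0 \<le> 15 * K * B"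
  proof -
    show "\<tau>\<^sub>0 \<le> 15 * K * B" using tau_rate(2) by (simp only: \<tau>\<^sub>0_def K_def B_def)
    have "0 \<le> ln (exp 1 * real p) / n" using U_facts(4) by (simp add: L_def)
    then show "0 < \<tau>\<^sub>0" using U_facts(1) pos \<gamma> unfolding \<tau>\<^sub>0_def
      by (subst tau_bound_eq) (auto intro!: divide_pos_pos add_nonneg_pos mult_nonneg_nonneg)
  qed
  have \<tau>_pos: "0 < \<tau>" using \<tau> \<tau>\<^sub>0 by (simp add: \<tau>\<^sub>0_def U_def)
  obtain \<mu> \<nu> where laws: "gaussian_law p \<Sigma> \<mu>" "has_char_fun p \<nu> \<psi>" and P_eq: "P = obs_law n p \<mu> \<nu>"
    using P by (auto simp: joint_law_def)
  have vl: "vec_law p \<mu>" "vec_law p \<nu>" using laws by (auto simp: gaussian_law_def has_char_fun_def)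
  define \<rho> where "\<rho> = sum_law p \<mu> \<nu>"
  have \<rho>: "vec_law p \<rho>" unfolding \<rho>_def by (rule vec_law_sum_law[OF vl])
  have P_PiM: "P = (\<Pi>\<^sub>M j\<in>{..<n}. \<rho>)" unfolding P_eq \<rho>_def by (rule obs_law_eq_PiM[OF vl])
  interpret P: prob_space P unfolding P_PiM using \<rho> by (intro prob_space_PiM) (simp add: vec_law_def)
  have \<Sigma>_facts: "symmetric_mat p \<Sigma>" "pos_definite p \<Sigma>" "mat_max_abs p \<Sigma> \<le> R" "mat_sum_powr p q \<Sigma> \<le> S"
    using \<Sigma> by (auto simp: sparse_class_def mat_card_nonzero_eq split: if_splits)
  have \<phi>: "vec_char p \<rho> u = of_real (exp (- ip p u (mat_vec p \<Sigma> u) / 2)) * \<psi> u" if "\<exists>i<p. u i \<noteq> 0" for u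
    using vec_char_gaussian[OF laws(1) \<Sigma>_facts(2) that] laws(2)
    by (simp add: \<rho>_def vec_char_sum_law[OF vl] has_char_fun_def)
  \<comment> \<open>The axis directions sit on the diagonal of the index set, so one union bound
    over p^2 pairs covers all directions.\<close>
  define dir where "dir i j = (if i = j then (\<lambda>k. U * unit_dir i k) else (\<lambda>k. U * pair_dir i j k))" for i j
  have t: "t \<ge> 0" using \<gamma> U_facts by (simp add: t_def)
  have "\<exists>E. \<forall>i j. E i j \<in> sets P \<and> measure P (E i j) \<le> 4 * exp (- real n * t\<^sup>2 / 2) \<and>
     (\<forall>Y\<in>space P - E i j. cmod (emp_char n p Y (dir i j) - vec_char p \<rho> (dir i j)) \<le> sqrt 2 * t)"
    using emp_char_deviation[OF \<rho> U_facts(5) t] unfolding P_PiM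
    by (intro choice allI) (auto simp: Bex_def)
  then obtain E where E_sets: "\<And>i j. E i j \<in> sets P"
    and E_prob: "\<And>i j. measure P (E i j) \<le> 4 * exp (- real n * t\<^sup>2 / 2)"
    and E_dev: "\<And>i j Y. Y \<in> space P - E i j \<Longrightarrow>
      cmod (emp_char n p Y (dir i j) - vec_char p \<rho> (dir i j)) \<le> sqrt 2 * t"
    by blast
  have exp_eq: "exp (- real n * t\<^sup>2 / 2) = (exp 1 * real p) powr (- (\<gamma>\<^sup>2))"
  proof -
    have "t\<^sup>2 = \<gamma>\<^sup>2 * (2 * L / n)"
      unfolding t_def power_mult_distrib using U_facts(4) by (subst real_sqrt_pow2) auto
    then show ?thesis using U_facts(5) pos by (simp add: powr_def L_def)
  qed
  have delta: "sqrt 2 * t = 2 * \<gamma> * sqrt (L / n)"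
    by (simp add: t_def real_sqrt_mult real_sqrt_divide)
  let ?E = "\<Union>(i, j)\<in>{..<p} \<times> {..<p}. E i j"
  have E_meas: "?E \<in> sets P" using E_sets by (intro sets.finite_UN) auto
  have "?bad \<subseteq> ?E"
  proof
    fix Y assume Y: "Y \<in> ?bad"
    show "Y \<in> ?E"
    proof (rule ccontr)
      assume "Y \<notin> ?E"
      then have "cmod (emp_char n p Y (dir i j) - vec_char p \<rho> (dir i j)) \<le> 2 * \<gamma> * sqrt (L / n)"
        if "i < p" "j < p" for i j
        using E_dev[of Y i j] that Y by (auto simp: delta)
      then have dev: "i < p \<Longrightarrow> cmod (emp_char n p Y (\<lambda>k. U * unit_dir i k) - vec_char p \<rho> (\<lambda>k. U * unit_dir i k))
            \<le> 2 * \<gamma> * sqrt (L / n)"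
        "i < p \<Longrightarrow> j < p \<Longrightarrow> i \<noteq> j \<Longrightarrow>
          cmod (emp_char n p Y (\<lambda>k. U * pair_dir i j k) - vec_char p \<rho> (\<lambda>k. U * pair_dir i j k))
            \<le> 2 * \<gamma> * sqrt (L / n)" for i j
        unfolding dir_def by (fastforce split: if_splits)+
      have err: "\<bar>spectral_cov n p U Y i j - \<Sigma> i j / 2\<bar> \<le> c * \<tau>" if "i < p" "j < p" for i j
      proof -
        have "\<bar>spectral_cov n p U Y i j - \<Sigma> i j / 2\<bar> \<le> c * \<tau>\<^sub>0"
          unfolding c_def \<tau>\<^sub>0_def
        proof (rule spectral_cov_error[OF pos(4,5,1,2) \<gamma> pos(9) U_def L_def M[folded U_def] \<Sigma>_facts(1,3), where \<psi> = \<psi> and \<phi> = "vec_char p \<rho>"])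
          show "\<psi> u \<noteq> 0" "\<bar>ln (cmod (\<psi> u))\<bar> \<le> T * (1 + (\<Sum>i<p. \<bar>u i\<bar> powr \<beta>))" for u
            using \<psi> by (auto simp: noise_class_def)
          show "cmod (\<psi> u) \<le> 1" for u by (rule char_fun_le_1[OF laws(2)])
        qed (fact \<phi> dev that)+
        also have "c * \<tau>\<^sub>0 \<le> c * \<tau>" using \<tau> c by (intro mult_left_mono) (auto simp: \<tau>\<^sub>0_def U_def)
        finally show ?thesis .
      qed
      have rate: "rate n p q S R T \<beta> = S powr (1/2) * B powr a"
        by (simp add: rate_def B_def a_def L_def)
      have a: "0 < a" "a \<le> 1" using pos by (auto simp: a_def)
      have "\<tau> powr a = (\<tau> / \<tau>\<^sub>0) powr a * \<tau>\<^sub>0 powr a"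
        using \<tau>_pos \<tau>\<^sub>0 by (simp flip: powr_mult)
      also have "\<tau>\<^sub>0 powr a \<le> (15 * K * B) powr a" using a \<tau>\<^sub>0 by (intro powr_mono2) auto
      also have "\<dots> = (15 * K) powr a * B powr a" using K B by (simp add: powr_mult)
      also have "(15 * K) powr a \<le> (15 * K) powr 1" using K a by (intro powr_mono) auto
      finally have \<tau>a: "\<tau> powr a \<le> 15 * K * ((\<tau> / \<tau>\<^sub>0) powr a * B powr a)"
        using K by (simp add: mult_left_mono mult_right_mono mult_ac)
      have "frob_norm p (\<lambda>i j. 2 * hard_threshold \<tau> (spectral_cov n p U Y) i j - \<Sigma> i j)
          \<le> 4 / (1 - c) * S powr (1/2) * \<tau> powr a"
        unfolding a_def by (rule frob_norm_hard_threshold[OF err \<tau>_pos c pos(7,8) \<Sigma>_facts(4)])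
      also have "\<dots> \<le> 4 / (1 - c) * S powr (1/2) * (15 * K * ((\<tau> / \<tau>\<^sub>0) powr a * B powr a))"
        using c by (intro mult_left_mono \<tau>a) auto
      also have "\<dots> = (C - 1) * ((\<tau> / \<tau>\<^sub>0) powr a * rate n p q S R T \<beta>)"
        by (simp add: C K_def c_def rate)
      \<comment> \<open>The \<open>+ 1\<close> in C gives strictness, which excludes the event
        defined with a weak inequality.\<close>
      also have "\<dots> < C * ((\<tau> / \<tau>\<^sub>0) powr a * rate n p q S R T \<beta>)"
        using \<tau>_pos \<tau>\<^sub>0 pos B by (intro mult_strict_right_mono) (auto simp: rate)
      finally show False using Y by (simp add: U_def \<tau>\<^sub>0_def a_def mult.assoc)
    qed
  qed
  \<comment> \<open>\<open>emeasure_mono\<close> asks for measurability of the covering set, here a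
    finite union of the measurable sets \<open>E i j\<close>.\<close>
  then have "emeasure P ?bad \<le> emeasure P ?E" by (rule emeasure_mono[OF _ E_meas])
  also have "\<dots> = ennreal (measure P ?E)" by (rule P.emeasure_eq_measure)
  also have "measure P ?E \<le> (\<Sum>(i, j)\<in>{..<p} \<times> {..<p}. measure P (E i j))"
    using measure_UNION_le[of "{..<p} \<times> {..<p}" "\<lambda>(i, j). E i j" P] E_sets by (auto simp: case_prod_beta)
  also have "\<dots> \<le> (\<Sum>(i, j)\<in>{..<p} \<times> {..<p}. 4 * exp (- real n * t\<^sup>2 / 2))"
    using E_prob by (intro sum_mono) auto
  also have "\<dots> = 4 * (real p powr 2 * (exp 1 * real p) powr (- (\<gamma>\<^sup>2)))"
    using pos unfolding exp_eq by (simp add: power2_eq_square)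
  also have "\<dots> \<le> 4 * (real p powr 2 * real p powr (- (\<gamma>\<^sup>2)))"
    using pos by (intro mult_left_mono powr_mono2') (auto simp: mult_le_cancel_right1)
  also have "\<dots> = 4 * real p powr (2 - \<gamma>\<^sup>2)"
    by (simp only: powr_add[symmetric]) simp
  finally show ?thesis by (simp add: ennreal_leI)
qed

theorem theorem5:
  "\<exists>cbar > 0. \<exists>C0 > 0. \<forall>\<beta> \<gamma> :: real. 0 < \<beta> \<and> \<beta> < 2 \<and> sqrt 2 < \<gamma> \<longrightarrow> (\<exists>C1 > 0.
     \<forall>(R :: real) (T :: real) (S :: real) (q :: real) (n :: nat) (p :: nat) (\<tau> :: real).
       0 < R \<and> 0 < T \<and> 0 < S \<and> 0 \<le> q \<and> q < 2 \<and> 1 \<le> p \<and>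
       U_star n p R \<gamma> \<ge>
         Max {(3 * T / R) powr (1 / (2 - \<beta>)), (cbar / T) powr (1 / \<beta>), 1} \<and>
       \<tau> \<ge> tau_bound n p R T \<beta> \<gamma> (U_star n p R \<gamma>)
       \<longrightarrow>
       (SUP (\<Sigma>, \<psi>) \<in> sparse_class p q S R \<times> noise_class p \<beta> T.
        SUP P \<in> {P. joint_law n p \<Sigma> \<psi> P}.
          emeasure P {Y \<in> space P.
            frob_norm p (\<lambda>i j.
              2 * hard_threshold \<tau> (spectral_cov n p (U_star n p R \<gamma>) Y) i j - \<Sigma> i j)
            \<ge> C1 * (\<tau> / tau_bound n p R T \<beta> \<gamma> (U_star n p R \<gamma>)) powr (1 - q / 2)
                * rate n p q S R T \<beta>})
       \<le> ennreal (C0 * real p powr (2 - \<gamma>\<^sup>2)))"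
proof (rule exI[of _ 1], rule conjI, simp, rule exI[of _ 4], rule conjI, simp, intro allI impI)
  \<comment> \<open>The witnesses are 1 for \<open>cbar\<close> and 4 for \<open>C0\<close>, the
    latter from the two tails of each of the real and imaginary parts.\<close>
  fix \<beta> \<gamma> :: real
  assume a: "0 < \<beta> \<and> \<beta> < 2 \<and> sqrt 2 < \<gamma>"
  have \<gamma>: "1 \<le> \<gamma>" using a real_sqrt_ge_1_iff[of 2] by linarith
  define C where "C = 60 * (1 + ln (64 * \<gamma>\<^sup>2)) / (1 - max (8/9) ((1 + 2 powr (1 - \<beta>/2)) / 3)) + 1"
  \<comment> \<open>Strictness uses \<beta> > 0 and keeps the denominator in C positive; it shrinks
    to 0 as \<beta> tends to 0, so C depends on \<beta> as well as on \<gamma>.\<close>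
  have "2 powr (1 - \<beta>/2) < (2::real) powr 1" using a by (intro powr_less_mono) auto
  moreover have "\<gamma>\<^sup>2 \<ge> 1" using \<gamma> by simp
  ultimately have "C > 0" unfolding C_def by (intro add_nonneg_pos divide_nonneg_nonneg) auto
  then show "\<exists>C1 > 0.
     \<forall>(R :: real) (T :: real) (S :: real) (q :: real) (n :: nat) (p :: nat) (\<tau> :: real).
       0 < R \<and> 0 < T \<and> 0 < S \<and> 0 \<le> q \<and> q < 2 \<and> 1 \<le> p \<and>
       U_star n p R \<gamma> \<ge>
         Max {(3 * T / R) powr (1 / (2 - \<beta>)), (1 / T) powr (1 / \<beta>), 1} \<and>
       \<tau> \<ge> tau_bound n p R T \<beta> \<gamma> (U_star n p R \<gamma>)
       \<longrightarrow>
       (SUP (\<Sigma>, \<psi>) \<in> sparse_class p q S R \<times> noise_class p \<beta> T.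
        SUP P \<in> {P. joint_law n p \<Sigma> \<psi> P}.
          emeasure P {Y \<in> space P.
            frob_norm p (\<lambda>i j.
              2 * hard_threshold \<tau> (spectral_cov n p (U_star n p R \<gamma>) Y) i j - \<Sigma> i j)
            \<ge> C1 * (\<tau> / tau_bound n p R T \<beta> \<gamma> (U_star n p R \<gamma>)) powr (1 - q / 2)
                * rate n p q S R T \<beta>})
       \<le> ennreal (4 * real p powr (2 - \<gamma>\<^sup>2))"
    using a \<gamma>
    by (intro exI[of _ C] conjI allI impI SUP_least)
      (auto intro!: SUP_least spectral_hard_threshold_deviation[OF _ _ _ _ _ _ _ _ _ _ _ _ _ _ C_def])
qed

end
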